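(* Let $L$ be a set of $n$ great circles on the sphere $S^2$ in general position (no three of them pass through a common pair of antipodal points), and consider the arrangement $\mathcal{A}(L)$ of vertices, edges and faces they determine. Then $C(L)\le 5$; that is, there exists a vertex $v$ of $\mathcal{A}(L)$ such that, if $\ell_1^v,\ell_2^v$ are the two great circles of $L$ passing through $v$, the face of the arrangement $\mathcal{A}(L\setminus\{\ell_1^v,\ell_2^v\})$ containing the point $v$ has size at most $5$.
   Context: For a set of great circles $L$ on the sphere, $\mathcal{A}(L)$ denotes the induced cell decomposition of the sphere; its vertices are the intersection points of pairs of circles in $L$. The size of a face is its number of edges (equivalently, of vertices on its boundary). For a vertex $v$ lying on the circles $\ell_1^v,\ell_2^v\in L$, $C(v)$ is the size of the face of $\mathcal{A}(L\setminus\{\ell_1^v,\ell_2^v\})$ containing $v$, and $C(L)=\min_v C(v)$ over all vertices $v$ of $\mathcal{A}(L)$ (so $L$ contains at least two circles). *)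

theory Defs
  imports "HOL-Analysis.Analysis"
begin

definition great_circle :: "(real^3) set \<Rightarrow> bool" where
  "great_circle C \<longleftrightarrow> (\<exists>u::real^3. u \<noteq> 0 \<and> C = {x \<in> sphere 0 1. inner u x = 0})"

text \<open>General position: no three distinct circles of L share a point
  (equivalently, a common pair of antipodal points).\<close>
definition general_position :: "(real^3) set set \<Rightarrow> bool" where
  "general_position L \<longleftrightarrow>
     (\<forall>l1\<in>L. \<forall>l2\<in>L. \<forall>l3\<in>L. l1 \<noteq> l2 \<and> l1 \<noteq> l3 \<and> l2 \<noteq> l3 \<longrightarrow> l1 \<inter> l2 \<inter> l3 = {})"

definition arr_vertices :: "(real^3) set set \<Rightarrow> (real^3) set" where
  "arr_vertices L = {x. \<exists>l1\<in>L. \<exists>l2\<in>L. l1 \<noteq> l2 \<and> x \<in> l1 \<and> x \<in> l2}"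

text \<open>The face of A(L) containing a point p not on any circle of L:
  the connected component of S^2 minus the circles that contains p.\<close>
definition arr_face :: "(real^3) set set \<Rightarrow> real^3 \<Rightarrow> (real^3) set" where
  "arr_face L p = connected_component_set (sphere 0 1 - \<Union>L) p"

definition face_size :: "(real^3) set set \<Rightarrow> (real^3) set \<Rightarrow> nat" where
  "face_size L F = card {w \<in> arr_vertices L. w \<in> frontier F}"

end

(* Describe each point of the sphere by its covector, the signs it has on normals of the circles.
   A vertex v lies on four cells, and the corners of these cells that lie on neither circle through v
   are exactly the vertices of the face around v after removal of the two circles; so C(v) is the sum
   of the four cell sizes minus 12.  Suppose C(v) >= 6, i.e. each such sum is at least 18.  As there are
   more cells than vertices, the sum over all cells of 4 - size is positive.  A discharging argument
   contradicts this: each cell of size s > 4 distributes its excess s - 4 evenly over its 2s half-edges,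
   and every half-edge passes its share on to nearby triangles in such a way that every triangle
   receives at least 1. *)
theory Submission
  imports Defs
begin

subsection \<open>Systems of vertices and cells\<close>

text \<open>A triangle with small neighbours cannot be paid by them alone, so cells that meet it
  only in a corner have to contribute, and then one half-edge may face several claims. The conflicts
  are limited by two rigidity facts: with at least four circles no two triangles share an edge, and
  with at least five no two triangles lie on opposite edges of a quadrilateral. Both come from the
  same source: two circles meet in an antipodal pair, and every further circle separates that pair,
  so apexes forced onto the same two circles cannot be different points. Arrangements of at most
  four circles are therefore treated apart. The counting runs on inequalities between finite sets of
  sign vectors. That cells outnumber vertices is obtained from deletion and restriction of planes
  through the origin, and topology enters only through the fact that a face lies on one side of each
  remaining circle.\<close>

definition incident :: "('a \<Rightarrow> real) \<Rightarrow> ('a \<Rightarrow> real) \<Rightarrow> bool" where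
  "incident v f \<longleftrightarrow> (\<forall>n. v n \<noteq> 0 \<longrightarrow> f n = v n)"

definition flip :: "'a \<Rightarrow> ('a \<Rightarrow> real) \<Rightarrow> 'a \<Rightarrow> real" where
  "flip a f = f(a := - f a)"

lemma flip_flip [simp]: "flip a (flip a f) = f"
  by (auto simp: flip_def)

lemma flip_commute: "flip a (flip b f) = flip b (flip a f)"
  by (auto simp: flip_def fun_eq_iff)

lemma flip_same [simp]: "flip a f a = - f a"
  by (simp add: flip_def)

lemma flip_other [simp]: "n \<noteq> a \<Longrightarrow> flip a f n = f n"
  by (simp add: flip_def)

lemma incidentD: "incident v f \<Longrightarrow> v n \<noteq> 0 \<Longrightarrow> f n = v n"
  by (simp add: incident_def)

lemma incident_flip: "incident v f \<Longrightarrow> v a = 0 \<Longrightarrow> incident v (flip a f)"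
  by (auto simp: incident_def flip_def)

text \<open>These are the properties of the sign vectors of vertices and cells that the counting
  uses. Negation is the antipodal map, and \<open>incident v f\<close> is the face relation: the
  vertex lies in the closure of the cell. Vectors vanish outside \<open>N\<close>, so that equal
  signs mean equal functions. On the sphere \<open>euler\<close> reflects that each vertex has four
  edge ends, so that V - E + F = 2 becomes F = V + 2.\<close>

locale covector_system =
  fixes N :: "'a set" and V F :: "('a \<Rightarrow> real) set"
  assumes finite_N: "finite N" and card_N: "3 \<le> card N"
    and finite_V: "finite V" and finite_F: "finite F"
    and vertex_zeros: "v \<in> V \<Longrightarrow> \<exists>a\<in>N. \<exists>b\<in>N. a \<noteq> b \<and> (\<forall>n\<in>N. v n = 0 \<longleftrightarrow> n = a \<or> n = b)"
    and vertex_unique: "\<lbrakk>v \<in> V; w \<in> V; a \<in> N; b \<in> N; a \<noteq> b; v a = 0; v b = 0; w a = 0; w b = 0\<rbrakk>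
      \<Longrightarrow> w = v \<or> w = (\<lambda>n. - v n)"
    and vertex_range: "v \<in> V \<Longrightarrow> v n = 0 \<or> v n = 1 \<or> v n = -1"
    and cell_range: "f \<in> F \<Longrightarrow> n \<in> N \<Longrightarrow> f n = 1 \<or> f n = -1"
    and cell_at_vertex: "\<lbrakk>v \<in> V; a \<in> N; b \<in> N; a \<noteq> b; v a = 0; v b = 0;
      \<alpha> = 1 \<or> \<alpha> = -1; \<beta> = 1 \<or> \<beta> = -1\<rbrakk> \<Longrightarrow> v(a := \<alpha>, b := \<beta>) \<in> F"
    and cell_has_vertex: "f \<in> F \<Longrightarrow> \<exists>v\<in>V. incident v f"
    and vertex_outside: "v \<in> V \<Longrightarrow> n \<notin> N \<Longrightarrow> v n = 0"
    and cell_outside: "f \<in> F \<Longrightarrow> n \<notin> N \<Longrightarrow> f n = 0"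
    and edge: "\<lbrakk>f \<in> F; v \<in> V; incident v f; a \<in> N; v a = 0\<rbrakk>
      \<Longrightarrow> \<exists>!w. w \<in> V \<and> incident w f \<and> w a = 0 \<and> w \<noteq> v"
    and euler: "card V < card F"
begin

definition corners :: "('a \<Rightarrow> real) \<Rightarrow> ('a \<Rightarrow> real) set" where
  "corners f = {v \<in> V. incident v f}"

definition cell_size :: "('a \<Rightarrow> real) \<Rightarrow> nat" where
  "cell_size f = card (corners f)"

definition other_line :: "('a \<Rightarrow> real) \<Rightarrow> 'a \<Rightarrow> 'a" where
  "other_line v a = (THE b. b \<in> N \<and> b \<noteq> a \<and> v b = 0)"

definition other_end :: "('a \<Rightarrow> real) \<Rightarrow> ('a \<Rightarrow> real) \<Rightarrow> 'a \<Rightarrow> 'a \<Rightarrow> real" where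
  "other_end f v a = (THE w. w \<in> V \<and> incident w f \<and> w a = 0 \<and> w \<noteq> v)"

section \<open>Lines through a vertex and edges of a cell\<close>

lemma vertex_nonzero:
  assumes "v \<in> V" "a \<in> N" "b \<in> N" "a \<noteq> b" "v a = 0" "v b = 0" "n \<in> N" "n \<noteq> a" "n \<noteq> b"
  shows "v n \<noteq> 0"
proof -
  obtain c d where cd: "\<And>n. n \<in> N \<Longrightarrow> v n = 0 \<longleftrightarrow> n = c \<or> n = d" using vertex_zeros[OF assms(1)] by auto
  then show ?thesis using cd[of a] cd[of b] cd[of n] assms by auto
qed

lemma other_line_eqI:
  assumes "v \<in> V" "a \<in> N" "v a = 0" "b \<in> N" "b \<noteq> a" "v b = 0"
  shows "other_line v a = b"
  unfolding other_line_def
proof (rule the_equality)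
  fix n assume "n \<in> N \<and> n \<noteq> a \<and> v n = 0"
  then show "n = b" using vertex_nonzero[of v a b n] assms by auto
qed (use assms in auto)

lemma other_line:
  assumes "v \<in> V" "a \<in> N" "v a = 0"
  shows "other_line v a \<in> N" "other_line v a \<noteq> a" "v (other_line v a) = 0"
proof -
  obtain c d where cd: "c \<in> N" "d \<in> N" "c \<noteq> d" "\<And>n. n \<in> N \<Longrightarrow> v n = 0 \<longleftrightarrow> n = c \<or> n = d"
    using vertex_zeros[OF assms(1)] by auto
  then obtain b where b: "b \<in> N" "b \<noteq> a" "v b = 0" using assms cd(4)[of a] cd(4)[of c] cd(4)[of d] by auto
  then have "other_line v a = b" using other_line_eqI assms by blast
  then show "other_line v a \<in> N" "other_line v a \<noteq> a" "v (other_line v a) = 0" using b by auto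
qed

lemma other_line_involution:
  assumes "v \<in> V" "a \<in> N" "v a = 0"
  shows "other_line v (other_line v a) = a"
  using other_line[OF assms] assms by (intro other_line_eqI) auto

lemma other_end:
  assumes "f \<in> F" "v \<in> V" "incident v f" "a \<in> N" "v a = 0"
  shows "other_end f v a \<in> V" "incident (other_end f v a) f" "other_end f v a a = 0" "other_end f v a \<noteq> v"
  using theI'[OF edge[OF assms]] unfolding other_end_def by auto

lemma other_end_eqI:
  assumes "f \<in> F" "v \<in> V" "incident v f" "a \<in> N" "v a = 0" "w \<in> V" "incident w f" "w a = 0" "w \<noteq> v"
  shows "other_end f v a = w"
  unfolding other_end_def using edge[OF assms(1-5)] assms(6-) by (intro the1_equality) auto

lemma other_end_involution:
  assumes "f \<in> F" "v \<in> V" "incident v f" "a \<in> N" "v a = 0"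
  shows "other_end f (other_end f v a) a = v"
  using other_end[OF assms] assms by (intro other_end_eqI) auto

lemma flip_cell:
  assumes "f \<in> F" "v \<in> V" "incident v f" "a \<in> N" "v a = 0"
  shows "flip a f \<in> F"
proof -
  note b = other_line[OF assms(2,4,5)]
  let ?b = "other_line v a"
  have "flip a f n = (v(a := - f a, ?b := f ?b)) n" for n
  proof (cases "n \<in> N \<and> n \<noteq> a \<and> n \<noteq> ?b")
    case True
    then have "v n \<noteq> 0" using vertex_nonzero[of v a ?b n] b b(2)[symmetric] assms by auto
    then show ?thesis using True assms(3) by (simp add: incidentD)
  next
    case False
    then show ?thesis using b(1,2) assms cell_outside[of f n] vertex_outside[of v n] by (auto simp: flip_def)
  qed
  then have "flip a f = v(a := - f a, ?b := f ?b)" by blast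
  moreover have "\<dots> \<in> F"
    using b assms cell_range[of f a] cell_range[of f ?b] by (intro cell_at_vertex) auto
  ultimately show ?thesis by simp
qed

lemma ex_line_avoiding:
  assumes "length xs < card N"
  shows "\<exists>n\<in>N. n \<notin> set xs"
proof (rule ccontr)
  assume "\<not> ?thesis"
  then have "card N \<le> card (set xs)" by (intro card_mono) auto
  then show False using assms card_length[of xs] by linarith
qed

lemma incident_vertices_eq:
  assumes "v \<in> V" "w \<in> V" "a \<in> N" "b \<in> N" "a \<noteq> b" "v a = 0" "v b = 0" "w a = 0" "w b = 0"
    and "n \<in> N" "n \<noteq> a" "n \<noteq> b" "w n = v n"
  shows "w = v"
  using vertex_unique[OF assms(1-9)] vertex_nonzero[OF assms(1,3-7) assms(10-12)] assms(13)
  by auto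

text \<open>The only other candidate for \<open>w\<close> is the antipode of \<open>v\<close>; a
  third line has opposite signs at the two, and a cell has only one sign there.\<close>

lemma incident_unique:
  assumes "v \<in> V" "w \<in> V" "incident v f" "incident w f"
    and "a \<in> N" "b \<in> N" "a \<noteq> b" "v a = 0" "v b = 0" "w a = 0" "w b = 0"
  shows "w = v"
proof -
  obtain n where "n \<in> N" "n \<noteq> a" "n \<noteq> b" using ex_line_avoiding[of "[a,b]"] card_N by auto
  moreover have "w n = v n"
    using calculation assms vertex_nonzero[of v a b n] vertex_nonzero[of w a b n] incidentD[of v f n] incidentD[of w f n]
    by simp
  ultimately show ?thesis using incident_vertices_eq assms by blast
qed

lemma other_end_line:
  assumes "f \<in> F" "v \<in> V" "incident v f" "a \<in> N" "v a = 0"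
  shows "other_end f v a (other_line v a) \<noteq> 0"
  using incident_unique[of v "other_end f v a" f a "other_line v a"] other_end[OF assms] other_line[OF assms(2,4,5)] assms
  by metis

lemma finite_corners [simp]: "finite (corners f)"
  using finite_V by (simp add: corners_def)

lemma corners_on_line:
  assumes "f \<in> F" "v \<in> corners f" "a \<in> N" "v a = 0"
  shows "{w \<in> corners f. w a = 0} = {v, other_end f v a}"
  using assms other_end[of f v a] other_end_eqI[of f v a] unfolding corners_def by blast

text \<open>A side of a cell has exactly two ends, so the sides on \<open>a\<close> and
  \<open>b\<close> contribute \<open>v\<close> and its two neighbours. The neighbours differ because
  the far end on \<open>a\<close> is off \<open>b\<close>. This 3, taken at the four cells around a
  vertex, is the source of the 12 in \<open>card_visible\<close>.\<close>

lemma corners_near: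
  assumes "f \<in> F" "v \<in> corners f" "a \<in> N" "b \<in> N" "a \<noteq> b" "v a = 0" "v b = 0"
  shows "{w \<in> corners f. w a = 0 \<or> w b = 0} = {v, other_end f v a, other_end f v b}"
    and "card {v, other_end f v a, other_end f v b} = 3"
proof -
  show "{w \<in> corners f. w a = 0 \<or> w b = 0} = {v, other_end f v a, other_end f v b}"
    using corners_on_line[of f v a] corners_on_line[of f v b] assms by blast
  have v: "v \<in> V" "incident v f" using assms by (auto simp: corners_def)
  have "other_line v a = b" using other_line_eqI assms v by auto
  then have "other_end f v a b \<noteq> 0" using other_end_line[of f v a] assms v by auto
  then have "other_end f v a \<noteq> other_end f v b" using other_end(3)[of f v b] assms v by metis
  then show "card {v, other_end f v a, other_end f v b} = 3"
    using other_end(4)[of f v a] other_end(4)[of f v b] assms v by auto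
qed

section \<open>Triangles and quadrilaterals\<close>

lemma cell_size_ge_3:
  assumes "f \<in> F" shows "3 \<le> cell_size f"
proof -
  obtain v where v: "v \<in> V" "incident v f" using cell_has_vertex assms by blast
  then obtain a b where "a \<in> N" "b \<in> N" "a \<noteq> b" "v a = 0" "v b = 0" using vertex_zeros[OF v(1)] by auto
  then have "card {w \<in> corners f. w a = 0 \<or> w b = 0} = 3" using corners_near[of f v a b] assms v
    by (simp add: corners_def)
  moreover have "card {w \<in> corners f. w a = 0 \<or> w b = 0} \<le> cell_size f"
    unfolding cell_size_def by (intro card_mono) auto
  ultimately show ?thesis by simp
qed

text \<open>The third side lies on the second line \<open>c\<close> through \<open>w\<close>. Its
  far end cannot be \<open>v\<close>, where only \<open>a\<close> and \<open>b\<close> vanish, so it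
  is the remaining corner \<open>z\<close>.\<close>

lemma triangle:
  assumes "f \<in> F" "cell_size f = 3" "v \<in> V" "incident v f" "a \<in> N" "b \<in> N" "a \<noteq> b" "v a = 0" "v b = 0"
  obtains c w z where "c \<in> N" "c \<noteq> a" "c \<noteq> b" "corners f = {v, w, z}" "v \<noteq> w" "v \<noteq> z" "w \<noteq> z"
    "w a = 0" "w c = 0" "z b = 0" "z c = 0" "w = other_end f v a" "z = other_end f v b"
    "other_line w a = c" "other_line z b = c"
proof -
  define w z where "w = other_end f v a" and "z = other_end f v b"
  have vc: "v \<in> corners f" using assms by (simp add: corners_def)
  have w: "w \<in> V" "incident w f" "w a = 0" "w \<noteq> v" using other_end[of f v a] assms by (auto simp: w_def)
  have z: "z \<in> V" "incident z f" "z b = 0" "z \<noteq> v" using other_end[of f v b] assms by (auto simp: z_def)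
  have "{v, w, z} \<subseteq> corners f" using w z vc by (auto simp: corners_def)
  moreover have c3: "card {v, w, z} = 3" using corners_near(2)[of f v a b] assms vc by (simp add: w_def z_def)
  ultimately have cor: "corners f = {v, w, z}"
    using card_subset_eq[of "corners f" "{v,w,z}"] assms(2) by (simp add: cell_size_def)
  have dist: "v \<noteq> w" "v \<noteq> z" "w \<noteq> z" using c3 by (auto simp: card_insert_if split: if_splits)
  define c where "c = other_line w a"
  have c: "c \<in> N" "c \<noteq> a" "w c = 0" using other_line[of w a] w assms unfolding c_def by auto
  have cb: "c \<noteq> b" using other_end_line[of f v a] other_line_eqI[of v a b] assms c unfolding w_def by auto
  have vcn: "v c \<noteq> 0" using vertex_nonzero[of v a b c] assms c cb by auto
  define y where "y = other_end f w c"
  have y: "y \<in> V" "incident y f" "y c = 0" "y \<noteq> w" using other_end[of f w c] assms w c by (auto simp: y_def)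
  then have "y = z" using cor vcn by (auto simp: corners_def)
  then have zc: "z c = 0" using y by simp
  have "other_line z b = c" using other_line_eqI z zc c cb assms by auto
  show ?thesis
    by (rule that[OF c(1,2) cb cor dist w(3) c(3) z(3) zc w_def z_def c_def[symmetric]]) fact
qed

text \<open>Two triangles sharing an edge have the same third vertex up to sign, so no further line fits.\<close>
lemma adjacent_triangle:
  assumes "4 \<le> card N" "f \<in> F" "v \<in> V" "incident v f" "a \<in> N" "v a = 0" "cell_size f = 3"
  shows "4 \<le> cell_size (flip a f)"
proof (rule ccontr)
  assume "\<not> ?thesis"
  have g: "flip a f \<in> F" "incident v (flip a f)" using flip_cell[of f v a] incident_flip[of v f a] assms by auto
  then have g3: "cell_size (flip a f) = 3" using cell_size_ge_3[of "flip a f"] \<open>\<not> _\<close> by linarith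
  define b where "b = other_line v a"
  have b: "b \<in> N" "a \<noteq> b" "v b = 0" using other_line[of v a] assms unfolding b_def by auto
  obtain c w z where 1: "c \<in> N" "c \<noteq> a" "c \<noteq> b" "corners f = {v, w, z}"
    "w a = 0" "w c = 0" "z b = 0" "z c = 0" "w = other_end f v a" "other_line w a = c"
    using triangle[OF assms(2,7,3,4,5) b(1,2) assms(6) b(3)] by metis
  obtain c' w' z' where 2: "c' \<in> N" "c' \<noteq> a" "c' \<noteq> b" "corners (flip a f) = {v, w', z'}"
    "w' a = 0" "w' c' = 0" "z' b = 0" "z' c' = 0" "w' = other_end (flip a f) v a" "other_line w' a = c'"
    using triangle[OF g(1) g3 assms(3) g(2) assms(5) b(1,2) assms(6) b(3)] by metis
  note w = other_end[OF assms(2,3,4,5,6)]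
  \<comment> \<open>Both cells have the same edge on \<open>a\<close>, hence the same far end and
    the same line crossing there; so both apexes lie on \<open>b\<close> and
    \<open>c\<close>.\<close>
  have "w' = w" unfolding 1 2 using assms g w incident_flip[of _ f a] by (intro other_end_eqI) auto
  then have "c' = c" using 1 2 by simp
  have z: "z \<in> V" "incident z f" "z' \<in> V" "incident z' (flip a f)"
    using 1(4) 2(4) by (auto simp: corners_def)
  have "z a \<noteq> 0" "z' a \<noteq> 0" using vertex_nonzero[of _ b c a] 1 2 z b assms \<open>c' = c\<close> by auto
  then have neq: "z' \<noteq> z" using z by (auto simp: incident_def flip_def)
  obtain n where n: "n \<in> N" "n \<noteq> a" "n \<noteq> b" "n \<noteq> c" using ex_line_avoiding[of "[a,b,c]"] assms(1) by auto
  then have "z n \<noteq> 0" "z' n \<noteq> 0" using vertex_nonzero[of _ b c n] 1 2 z b \<open>c' = c\<close> by auto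
  then have "z' n = z n" using z n by (metis incidentD flip_other)
  then have "z' = z" using incident_vertices_eq[of z z' b c n] z n 1 2 b \<open>c' = c\<close> by auto
  then show False using neq by simp
qed

text \<open>Two triangles on opposite edges of a quadrilateral would have antipodal apexes, both on the two remaining
  lines of the quadrilateral; then no fifth line fits.\<close>
lemma opposite_edges_quadrilateral:
  assumes "5 \<le> card N" "p \<in> F" "cell_size p = 4" "u \<in> V" "incident u p" "e \<in> N" "u e = 0"
    and d_def: "d = other_line u e" and w_def: "w = other_end p u e" and k_def: "k = other_line w e"
  shows "\<not> (cell_size (flip d p) = 3 \<and> cell_size (flip k p) = 3)"
proof
  assume tri: "cell_size (flip d p) = 3 \<and> cell_size (flip k p) = 3"
  have d: "d \<in> N" "d \<noteq> e" "u d = 0" using other_line[of u e] assms by auto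
  have w: "w \<in> V" "incident w p" "w e = 0" "w \<noteq> u" using other_end[of p u e] assms by auto
  have k: "k \<in> N" "k \<noteq> e" "w k = 0" using other_line[of w e] assms w by auto
  have dk: "d \<noteq> k" using other_end_line[of p u e] assms k by auto
  have o1: "flip d p \<in> F" "incident u (flip d p)" using flip_cell[of p u d] incident_flip[of u p d] assms d by auto
  have o2: "flip k p \<in> F" "incident w (flip k p)" using flip_cell[of p w k] incident_flip[of w p k] assms w k by auto
  obtain c m z where 1: "c \<in> N" "c \<noteq> e" "c \<noteq> d" "corners (flip d p) = {u, m, z}"
    "m d = 0" "m c = 0" "z e = 0" "z c = 0" "m = other_end (flip d p) u d"
    using triangle[OF o1(1) _ assms(4) o1(2) d(1) assms(6) d(2) d(3) assms(7)] tri by metis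
  obtain c' m' z' where 2: "c' \<in> N" "c' \<noteq> e" "c' \<noteq> k" "corners (flip k p) = {w, m', z'}"
    "m' k = 0" "m' c' = 0" "z' e = 0" "z' c' = 0" "m' = other_end (flip k p) w k"
    using triangle[OF o2(1) _ w(1) o2(2) k(1) assms(6) k(2) k(3) w(3)] tri by metis
  have m: "m \<in> V" "incident m p" "m \<noteq> u"
    using other_end[of "flip d p" u d] incident_flip[of m "flip d p" d] 1 o1 assms d by auto
  have m': "m' \<in> V" "incident m' p" "m' \<noteq> w"
    using other_end[of "flip k p" w k] incident_flip[of m' "flip k p" k] 2 o2 w k by auto
  have z: "z \<in> V" "incident z (flip d p)" "z' \<in> V" "incident z' (flip k p)"
    using 1(4) 2(4) by (auto simp: corners_def)
  have mw: "m \<noteq> w" "m' \<noteq> u"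
    using vertex_nonzero[of w e k d] vertex_nonzero[of u e d k] 1 2 w k d dk assms by auto
  have zd: "z d \<noteq> 0" "z d = - p d" using vertex_nonzero[of z e c d] 1 z d assms incidentD[of z "flip d p" d] by auto
  show False
  \<comment> \<open>\<open>m\<close> and \<open>m'\<close> are the far ends of the sides on
    \<open>d\<close> and \<open>k\<close>. If they coincide, the apex \<open>z\<close> lies on
    \<open>e\<close> and \<open>k\<close> and is forced to be \<open>w\<close>, although
    \<open>d\<close> separates the two. If not, all four corners are known and the fourth side lies
    on the line that carries both apexes.\<close>
  proof (cases "m = m'")
    case True
    then have "c = k" using 1 2 vertex_nonzero[of m d c k] m d k dk by auto
    have "w d \<noteq> 0" using vertex_nonzero[of w e k d] w k d dk assms by auto
    then have "w d \<noteq> z d" using w zd incidentD[of w p d] by auto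
    obtain n where n: "n \<in> N" "n \<noteq> e" "n \<noteq> d" "n \<noteq> k" using ex_line_avoiding[of "[e,d,k]"] assms(1) by auto
    then have "z n \<noteq> 0" "w n \<noteq> 0"
      using vertex_nonzero[of _ e k n] 1 z w k assms \<open>c = k\<close> by auto
    then have "z n = w n" using z w n by (metis incidentD flip_other)
    then have "z = w" using incident_vertices_eq[of w z e k n] z w n 1 k assms \<open>c = k\<close> by auto
    then show False using \<open>w d \<noteq> z d\<close> by simp
  next
    case False
    have sub: "{u, w, m, m'} \<subseteq> corners p" using assms w m m' by (auto simp: corners_def)
    have "card {u, w, m, m'} = 4" using False mw w m m' by auto
    then have cor: "corners p = {u, w, m, m'}"
      using card_subset_eq[OF finite_corners sub] assms(3) by (simp add: cell_size_def)
    define y where "y = other_end p m c"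
    have y: "y \<in> corners p" "y c = 0" "y \<noteq> m"
      using other_end[of p m c] m assms 1 by (auto simp: y_def corners_def)
    have "u c \<noteq> 0" using vertex_nonzero[of u e d c] 1 d assms by auto
    then consider "y = w" | "y = m'" using y cor by auto
    then have "c = k \<or> c = c'"
    proof cases
      case 1
      then show ?thesis using vertex_nonzero[of w e k c] y w k \<open>c \<in> N\<close> \<open>c \<noteq> e\<close> assms by auto
    next
      case 2
      then show ?thesis using vertex_nonzero[of m' k c' c] y m' k \<open>c \<in> N\<close> \<open>c' \<noteq> k\<close> \<open>c' \<in> N\<close> \<open>m' k = 0\<close> \<open>m' c' = 0\<close> by auto
    qed
    moreover have "c \<noteq> k"
    proof
      assume "c = k"
      then have "m = other_end p w k" using other_end_eqI[of p w k m] assms w k m mw 1 by auto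
      moreover have "m' = other_end p w k" using other_end_eqI[of p w k m'] assms w k m' 2 by auto
      ultimately show False using False by simp
    qed
    ultimately have c': "c' = c" by simp
    have z'd: "z' d = p d"
      using vertex_nonzero[of z' e c d] 1 2 z d c' dk assms incidentD[of z' "flip k p" d] by auto
    have "p d \<noteq> 0" using zd by auto
    obtain n where n: "n \<in> N" "n \<noteq> e" "n \<noteq> d" "n \<noteq> k" "n \<noteq> c"
      using ex_line_avoiding[of "[e,d,k,c]"] assms(1) by auto
    then have "z n \<noteq> 0" "z' n \<noteq> 0"
      using vertex_nonzero[of _ e c n] 1 2 z c' assms by auto
    then have "z' n = z n" using z n by (metis incidentD flip_other)
    then have "z' = z" using incident_vertices_eq[of z z' e c n] z n 1 2 c' assms by auto
    then show False using zd z'd \<open>p d \<noteq> 0\<close> by auto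
  qed
qed

end

subsection \<open>The charge at a triangle\<close>

text \<open>For sizes from 4 on this is 1/2 - 2/s, one of the 2s shares of the excess; the cut at 0
  keeps triangles from giving a negative charge.\<close>

definition half_charge :: "nat \<Rightarrow> real" where
  "half_charge s = max 0 ((real s - 4) / (2 * real s))"

lemma half_charge_nonneg [simp]: "0 \<le> half_charge s"
  by (simp add: half_charge_def)

lemma half_charge_mono:
  assumes "3 \<le> s" "s \<le> t" shows "half_charge s \<le> half_charge t"
proof -
  have "(real s - 4) / (2 * real s) = 1/2 - 2 / real s" "(real t - 4) / (2 * real t) = 1/2 - 2 / real t"
    using assms by (auto simp: field_simps)
  moreover have "2 / real t \<le> 2 / real s" using assms by (intro divide_left_mono) auto
  ultimately show ?thesis unfolding half_charge_def by (intro max.mono) auto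
qed

lemma half_charge_values [simp]:
  "half_charge 3 = 0" "half_charge 4 = 0" "half_charge 5 = 1/10" "half_charge 6 = 1/6"
  "half_charge 7 = 3/14" "half_charge 8 = 1/4"
  by (simp_all add: half_charge_def)

text \<open>What a triangle receives through one of its corners when p and q are the sizes of its two neighbours
  there and x is the size of the opposite cell.\<close>
definition corner_charge :: "nat \<Rightarrow> nat \<Rightarrow> nat \<Rightarrow> real" where
  "corner_charge p q x = half_charge p + half_charge q + 2 * half_charge x
     + (if 4 \<le> x then (half_charge p + half_charge q) / 2 else 0)
     + (if p = 4 then half_charge x / 2 else 0) + (if q = 4 then half_charge x / 2 else 0)"

lemma corner_charge_commute: "corner_charge p q x = corner_charge q p x"
  by (simp add: corner_charge_def)

text \<open>Reduces \<open>triangle_charge\<close> to finitely many sizes. The caps 8 and 7 are the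
  sizes from which 15 is reached whatever the other two cells are: 8 + 4 + 3 = 15 and 4 + 4 + 7 =
  15. Capping thus preserves the hypotheses on the sums.\<close>

lemma corner_charge_truncate:
  assumes "4 \<le> p" "4 \<le> q" "3 \<le> x"
  shows "corner_charge (min p 8) (min q 8) (min x 7) \<le> corner_charge p q x"
proof -
  have "half_charge (min p 8) \<le> half_charge p" "half_charge (min q 8) \<le> half_charge q"
    "half_charge (min x 7) \<le> half_charge x"
    using assms by (auto intro!: half_charge_mono)
  moreover have "min p 8 = 4 \<longleftrightarrow> p = 4" "min q 8 = 4 \<longleftrightarrow> q = 4" "4 \<le> min x 7 \<longleftrightarrow> 4 \<le> x" by auto
  ultimately show ?thesis unfolding corner_charge_def by (smt (verit) divide_right_mono)
qed

text \<open>Each constant is the charge at the smallest admissible \<open>x\<close>, the larger of 3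
  and 15 - p - q.\<close>

lemma corner_charge_values:
  assumes "15 \<le> p + q + x" "x = 3 \<or> x = 4 \<or> x = 5 \<or> x = 6 \<or> x = 7"
  shows "p = 4 \<Longrightarrow> q = 4 \<Longrightarrow> corner_charge p q x \<ge> 9/14"
    "p = 4 \<Longrightarrow> q = 5 \<Longrightarrow> corner_charge p q x \<ge> 17/30"
    "p = 4 \<Longrightarrow> q = 6 \<Longrightarrow> corner_charge p q x \<ge> 1/2"
    "p = 4 \<Longrightarrow> q = 7 \<Longrightarrow> corner_charge p q x \<ge> 9/28"
    "p = 4 \<Longrightarrow> q = 8 \<Longrightarrow> corner_charge p q x \<ge> 1/4"
    "p = 5 \<Longrightarrow> q = 5 \<Longrightarrow> corner_charge p q x \<ge> 1/2"
    "p = 5 \<Longrightarrow> q = 6 \<Longrightarrow> corner_charge p q x \<ge> 2/5"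
    "p = 5 \<Longrightarrow> q = 7 \<Longrightarrow> corner_charge p q x \<ge> 11/35"
    "p = 5 \<Longrightarrow> q = 8 \<Longrightarrow> corner_charge p q x \<ge> 7/20"
    "p = 6 \<Longrightarrow> q = 6 \<Longrightarrow> corner_charge p q x \<ge> 1/3"
    "p = 6 \<Longrightarrow> q = 7 \<Longrightarrow> corner_charge p q x \<ge> 8/21"
    "p = 6 \<Longrightarrow> q = 8 \<Longrightarrow> corner_charge p q x \<ge> 5/12"
    "p = 7 \<Longrightarrow> q = 7 \<Longrightarrow> corner_charge p q x \<ge> 3/7"
    "p = 7 \<Longrightarrow> q = 8 \<Longrightarrow> corner_charge p q x \<ge> 13/28"
    "p = 8 \<Longrightarrow> q = 8 \<Longrightarrow> corner_charge p q x \<ge> 1/2"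
  using assms by (auto simp: corner_charge_def)

text \<open>The sum of the three bounds is checked for every sorted triple. The margin is zero for
  neighbours of sizes 6, 6, 6 and 4, 8, 8 when the cells opposite at all corners are
  triangles.\<close>

lemma triangle_charge_sorted:
  assumes "p \<in> {4,5,6,7,8}" "q \<in> {4,5,6,7,8}" "r \<in> {4,5,6,7,8}"
    and "x \<in> {3,4,5,6,7}" "y \<in> {3,4,5,6,7}" "z \<in> {3,4,5,6,7}"
    and "15 \<le> p + q + x" "15 \<le> q + r + y" "15 \<le> p + r + z" "p \<le> q" "q \<le> r"
  shows "1 \<le> corner_charge p q x + corner_charge q r y + corner_charge p r z"
proof -
  note pq = corner_charge_values[of p q x] and qr = corner_charge_values[of q r y]
    and pr = corner_charge_values[of p r z]
  have x: "x = 3 \<or> x = 4 \<or> x = 5 \<or> x = 6 \<or> x = 7" and y: "y = 3 \<or> y = 4 \<or> y = 5 \<or> y = 6 \<or> y = 7"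
    and z: "z = 3 \<or> z = 4 \<or> z = 5 \<or> z = 6 \<or> z = 7" using assms by auto
  note pq = pq[OF assms(7) x] and qr = qr[OF assms(8) y] and pr = pr[OF assms(9) z]
  consider "p = 4" | "p = 5" | "p = 6" | "p = 7" | "p = 8" using assms(1) by auto
  then show ?thesis
  proof cases
    case 1
    consider "q = 4" | "q = 5" | "q = 6" | "q = 7" | "q = 8" using assms(2) by auto
    then show ?thesis by cases (use 1 pq qr pr assms(3,10,11) in auto)
  next
    case 2
    consider "q = 5" | "q = 6" | "q = 7" | "q = 8" using assms(2,10) 2 by auto
    then show ?thesis by cases (use 2 pq qr pr assms(3,10,11) in auto)
  next
    case 3
    consider "q = 6" | "q = 7" | "q = 8" using assms(2,10) 3 by auto
    then show ?thesis by cases (use 3 pq qr pr assms(3,10,11) in auto)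
  next
    case 4
    consider "q = 7" | "q = 8" using assms(2,10) 4 by auto
    then show ?thesis by cases (use 4 pq qr pr assms(3,10,11) in auto)
  next
    case 5
    then show ?thesis using pq qr pr assms(2,3,10,11) by auto
  qed
qed

lemma triangle_charge:
  assumes "4 \<le> p" "4 \<le> q" "4 \<le> r" "3 \<le> x" "3 \<le> y" "3 \<le> z"
    and "15 \<le> p + q + x" "15 \<le> q + r + y" "15 \<le> p + r + z"
  shows "1 \<le> corner_charge p q x + corner_charge q r y + corner_charge p r z"
proof -
  have sorted: "1 \<le> corner_charge p q x + corner_charge q r y + corner_charge p r z"
    if "4 \<le> p" "4 \<le> q" "4 \<le> r" "3 \<le> x" "3 \<le> y" "3 \<le> z"
      "15 \<le> p + q + x" "15 \<le> q + r + y" "15 \<le> p + r + z" "p \<le> q" "q \<le> r" for p q r x y z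
  proof -
    have "1 \<le> corner_charge (min p 8) (min q 8) (min x 7) + corner_charge (min q 8) (min r 8) (min y 7)
        + corner_charge (min p 8) (min r 8) (min z 7)"
      using that by (intro triangle_charge_sorted) (auto simp: min_def)
    then show ?thesis
      using corner_charge_truncate[of p q x] corner_charge_truncate[of q r y] corner_charge_truncate[of p r z] that
      by linarith
  qed
  have "p \<le> q \<and> q \<le> r \<or> p \<le> r \<and> r \<le> q \<or> q \<le> p \<and> p \<le> r \<or> q \<le> r \<and> r \<le> p \<or> r \<le> p \<and> p \<le> q \<or> r \<le> q \<and> q \<le> p"
    by linarith
  then show ?thesis
    using sorted[of p q r x y z] sorted[of p r q z y x] sorted[of q p r x z y] sorted[of q r p y z x]
      sorted[of r p q z x y] sorted[of r q p y x z] assms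
      corner_charge_commute[of q p] corner_charge_commute[of r p] corner_charge_commute[of r q]
    by (auto simp: add.commute add.left_commute)
qed

subsection \<open>Discharging\<close>

context covector_system
begin

text \<open>A triple (f, v, a) stands for the half-edge of the cell f at its corner v on the line a.\<close>
definition flags :: "(('a \<Rightarrow> real) \<times> ('a \<Rightarrow> real) \<times> 'a) set" where
  "flags = {(f, v, a). f \<in> F \<and> v \<in> V \<and> incident v f \<and> a \<in> N \<and> v a = 0}"

text \<open>\<open>across\<close>, \<open>turn\<close> and \<open>slide\<close> are the usual flag
  involutions of a map on a surface, changing the cell, the edge and the vertex. Every transfer of
  charge is a composition of them, hence a bijection of \<open>flags\<close>, and this makes charge
  given and charge received comparable.\<close>

definition across :: "('a \<Rightarrow> real) \<times> ('a \<Rightarrow> real) \<times> 'a \<Rightarrow> ('a \<Rightarrow> real) \<times> ('a \<Rightarrow> real) \<times> 'a" where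
  "across = (\<lambda>(f, v, a). (flip a f, v, a))"

definition turn :: "('a \<Rightarrow> real) \<times> ('a \<Rightarrow> real) \<times> 'a \<Rightarrow> ('a \<Rightarrow> real) \<times> ('a \<Rightarrow> real) \<times> 'a" where
  "turn = (\<lambda>(f, v, a). (f, v, other_line v a))"

definition slide :: "('a \<Rightarrow> real) \<times> ('a \<Rightarrow> real) \<times> 'a \<Rightarrow> ('a \<Rightarrow> real) \<times> ('a \<Rightarrow> real) \<times> 'a" where
  "slide = (\<lambda>(f, v, a). (f, other_end f v a, a))"

lemma across_flag: "\<psi> \<in> flags \<Longrightarrow> across \<psi> \<in> flags" "\<psi> \<in> flags \<Longrightarrow> across (across \<psi>) = \<psi>"
  using flip_cell incident_flip by (fastforce simp: flags_def across_def)+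

lemma turn_flag: "\<psi> \<in> flags \<Longrightarrow> turn \<psi> \<in> flags" "\<psi> \<in> flags \<Longrightarrow> turn (turn \<psi>) = \<psi>"
  using other_line other_line_involution by (auto simp: flags_def turn_def)

lemma slide_flag: "\<psi> \<in> flags \<Longrightarrow> slide \<psi> \<in> flags" "\<psi> \<in> flags \<Longrightarrow> slide (slide \<psi>) = \<psi>"
  using other_end other_end_involution by (auto simp: flags_def slide_def)

lemma sum_flags:
  fixes h :: "_ \<Rightarrow> _ \<Rightarrow> _ \<Rightarrow> real"
  shows "(\<Sum>(f, v, a)\<in>flags. h f v a) = (\<Sum>f\<in>F. \<Sum>v\<in>corners f. \<Sum>a\<in>{a\<in>N. v a = 0}. h f v a)"
proof -
  have "flags = Sigma F (\<lambda>f. Sigma (corners f) (\<lambda>v. {a\<in>N. v a = 0}))"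
    by (auto simp: flags_def corners_def)
  then show ?thesis using finite_N finite_F by (simp add: sum.Sigma)
qed

lemma lines_at_vertex:
  assumes "v \<in> V" "a \<in> N" "b \<in> N" "a \<noteq> b" "v a = 0" "v b = 0"
  shows "{n\<in>N. v n = 0} = {a, b}"
  using vertex_nonzero[OF assms] assms by auto

lemma sum_lines_at_vertex:
  fixes h :: "_ \<Rightarrow> real"
  assumes "v \<in> V" "a \<in> N" "b \<in> N" "a \<noteq> b" "v a = 0" "v b = 0"
  shows "(\<Sum>n\<in>{n\<in>N. v n = 0}. h n) = h a + h b"
  using assms(4) by (simp add: lines_at_vertex[OF assms])

abbreviation tri :: "('a \<Rightarrow> real) \<Rightarrow> bool" where
  "tri f \<equiv> cell_size f = 3"

abbreviation weight :: "('a \<Rightarrow> real) \<Rightarrow> real" where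
  "weight f \<equiv> half_charge (cell_size f)"

text \<open>The four summands are the fractions of its charge that the half-edge at u on e gives away: all of it
  to a triangle across e or, failing that, to a triangle opposite at u; otherwise one half each to the
  triangle across the other line at u, and to the triangle opposite at the far end of e provided that
  the cell across e is a quadrilateral.\<close>
lemma half_edge_budget:
  assumes "5 \<le> card N" "(f, u, e) \<in> flags"
  defines "d \<equiv> other_line u e" and "k \<equiv> other_line (other_end f u e) e"
  shows "of_bool (tri (flip e f)) + of_bool (tri (flip e (flip d f)))
    + of_bool (tri (flip d f) \<and> 4 \<le> cell_size (flip e f)) / 2
    + of_bool (tri (flip e (flip k f)) \<and> cell_size (flip e f) = 4) / 2 \<le> (1 :: real)"
proof -
  have fl: "f \<in> F" "u \<in> V" "incident u f" "e \<in> N" "u e = 0" using assms by (auto simp: flags_def)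
  have d: "d \<in> N" "d \<noteq> e" "u d = 0" using other_line[of u e] fl by (auto simp: d_def)
  have p: "flip e f \<in> F" "incident u (flip e f)" using flip_cell[of f u e] incident_flip[of u f e] fl by auto
  have q: "flip d f \<in> F" "incident u (flip d f)" using flip_cell[of f u d] incident_flip[of u f d] fl d by auto
  \<comment> \<open>The cell opposite at \<open>u\<close> shares an edge on \<open>d\<close> with
    the cell across \<open>e\<close>, and an edge on \<open>e\<close> with the cell across
    \<open>d\<close>; so it is not a triangle if one of these is.\<close>
  have 1: "tri (flip e f) \<Longrightarrow> \<not> tri (flip e (flip d f))"
    using adjacent_triangle[of "flip e f" u d] p d fl assms(1) by (simp add: flip_commute[of e d])
  have 2: "tri (flip d f) \<Longrightarrow> \<not> tri (flip e (flip d f))"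
    using adjacent_triangle[of "flip d f" u e] q fl assms(1) by simp
  have w: "other_end (flip e f) u e = other_end f u e"
    using other_end[of f u e] incident_flip[of "other_end f u e" f e] fl p by (intro other_end_eqI) auto
  \<comment> \<open>Seen from the quadrilateral \<open>flip e f\<close>, the two cells lie across
    its sides on \<open>d\<close> and \<open>k\<close>, which are the two neighbours of its side on
    \<open>e\<close>.\<close>
  have 3: "cell_size (flip e f) = 4 \<Longrightarrow> tri (flip e (flip d f)) \<Longrightarrow> \<not> tri (flip e (flip k f))"
    using opposite_edges_quadrilateral[of "flip e f" u e d "other_end f u e" k] p fl assms(1) w
    by (auto simp: d_def k_def flip_commute[of e])
  show ?thesis using 1 2 3 by (auto simp: of_bool_def)
qed

text \<open>The same transfers, collected at the flags of the receiving triangle.\<close>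
definition received :: "('a \<Rightarrow> real) \<Rightarrow> ('a \<Rightarrow> real) \<Rightarrow> 'a \<Rightarrow> real" where
  "received f v a = (let b = other_line v a; x = flip a (flip b f) in
     weight (flip a f) + weight x + of_bool (4 \<le> cell_size x) * weight (flip a f) / 2
     + of_bool (cell_size (flip b f) = 4) * weight x / 2)"

lemma received_le_weight:
  assumes "5 \<le> card N"
  shows "(\<Sum>(f, v, a)\<in>flags. of_bool (tri f) * received f v a) \<le> (\<Sum>(f, v, a)\<in>flags. weight f)"
proof -
  define T :: "_ \<Rightarrow> real" where "T \<psi> = of_bool (tri (fst \<psi>))" for \<psi> :: "('a \<Rightarrow> real) \<times> ('a \<Rightarrow> real) \<times> 'a"
  define W where "W \<psi> = weight (fst \<psi>)" for \<psi> :: "('a \<Rightarrow> real) \<times> ('a \<Rightarrow> real) \<times> 'a"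
  define S where "S \<psi> = cell_size (fst \<psi>)" for \<psi> :: "('a \<Rightarrow> real) \<times> ('a \<Rightarrow> real) \<times> 'a"
  define opp where "opp \<psi> = across (turn (across \<psi>))" for \<psi>
  \<comment> \<open>The argument of each \<open>W\<close> is the paying half-edge: that of the
    neighbour across \<open>a\<close>; that of the opposite cell at the same corner on
    \<open>a\<close>; that of the neighbour across \<open>a\<close> on the other line; and that of
    the opposite cell at the far end of its edge on \<open>a\<close>.\<close>
  have rec: "(case \<psi> of (f, v, a) \<Rightarrow> of_bool (tri f) * received f v a) =
      T \<psi> * W (across \<psi>) + T \<psi> * W (turn (opp \<psi>))
      + T \<psi> * of_bool (4 \<le> S (opp \<psi>)) * W (turn (across \<psi>)) / 2
      + T \<psi> * of_bool (S (across (turn \<psi>)) = 4) * W (slide (turn (opp \<psi>))) / 2"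
    if "\<psi> \<in> flags" for \<psi>
    by (cases \<psi>) (simp add: T_def W_def S_def opp_def across_def turn_def slide_def received_def
        Let_def flip_commute algebra_simps)
  note flag_moves = across_flag turn_flag slide_flag
  have t1: "(\<Sum>\<psi>\<in>flags. T \<psi> * W (across \<psi>)) = (\<Sum>\<psi>\<in>flags. T (across \<psi>) * W \<psi>)"
    by (rule sum.reindex_bij_witness[where i = across and j = across]) (simp_all add: flag_moves)
  have t2: "(\<Sum>\<psi>\<in>flags. T \<psi> * W (turn (opp \<psi>))) = (\<Sum>\<psi>\<in>flags. T (opp (turn \<psi>)) * W \<psi>)"
    by (rule sum.reindex_bij_witness[where i = "\<lambda>\<psi>. opp (turn \<psi>)" and j = "\<lambda>\<psi>. turn (opp \<psi>)"])
      (simp_all add: flag_moves opp_def)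
  have t3: "(\<Sum>\<psi>\<in>flags. T \<psi> * of_bool (4 \<le> S (opp \<psi>)) * W (turn (across \<psi>)) / 2)
      = (\<Sum>\<psi>\<in>flags. T (across (turn \<psi>)) * of_bool (4 \<le> S (across \<psi>)) * W \<psi> / 2)"
    by (rule sum.reindex_bij_witness[where i = "\<lambda>\<psi>. across (turn \<psi>)" and j = "\<lambda>\<psi>. turn (across \<psi>)"])
      (simp_all add: flag_moves opp_def)
  have S: "S (across (slide (turn (opp \<psi>)))) = S (across (turn \<psi>))" if "\<psi> \<in> flags" for \<psi>
    using that other_line_involution
    by (cases \<psi>) (auto simp: flags_def S_def opp_def across_def turn_def slide_def flip_commute)
  have t4: "(\<Sum>\<psi>\<in>flags. T \<psi> * of_bool (S (across (turn \<psi>)) = 4) * W (slide (turn (opp \<psi>))) / 2)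
      = (\<Sum>\<psi>\<in>flags. T (opp (turn (slide \<psi>))) * of_bool (S (across \<psi>) = 4) * W \<psi> / 2)"
    by (rule sum.reindex_bij_witness[where i = "\<lambda>\<psi>. opp (turn (slide \<psi>))" and j = "\<lambda>\<psi>. slide (turn (opp \<psi>))"])
      (simp_all add: S, simp_all add: flag_moves opp_def)
  have "(\<Sum>(f, v, a)\<in>flags. of_bool (tri f) * received f v a) =
      (\<Sum>\<psi>\<in>flags. T \<psi> * W (across \<psi>) + T \<psi> * W (turn (opp \<psi>))
      + T \<psi> * of_bool (4 \<le> S (opp \<psi>)) * W (turn (across \<psi>)) / 2
      + T \<psi> * of_bool (S (across (turn \<psi>)) = 4) * W (slide (turn (opp \<psi>))) / 2)"
    by (rule sum.cong[OF refl rec])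
  \<comment> \<open>After reindexing by the payer, the coefficient of \<open>W \<psi>\<close> is the
    total fraction that \<open>\<psi>\<close> gives away, which \<open>half_edge_budget\<close>
    bounds by 1.\<close>
  also have "\<dots> = (\<Sum>\<psi>\<in>flags. (T (across \<psi>) + T (opp (turn \<psi>)) + T (across (turn \<psi>)) * of_bool (4 \<le> S (across \<psi>)) / 2
        + T (opp (turn (slide \<psi>))) * of_bool (S (across \<psi>) = 4) / 2) * W \<psi>)"
    by (simp only: sum.distrib t1 t2 t3 t4 distrib_right times_divide_eq_left)
  also have "\<dots> \<le> (\<Sum>\<psi>\<in>flags. 1 * W \<psi>)"
  proof (intro sum_mono mult_right_mono)
    fix \<psi> assume \<psi>: "\<psi> \<in> flags"
    obtain f u e where [simp]: "\<psi> = (f, u, e)" by (cases \<psi>)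
    have fl: "f \<in> F" "u \<in> V" "incident u f" "e \<in> N" "u e = 0" using \<psi> by (auto simp: flags_def)
    have inv: "other_line u (other_line u e) = e"
      "other_line (other_end f u e) (other_line (other_end f u e) e) = e"
      using other_line_involution other_end[OF fl] fl by auto
    show "T (across \<psi>) + T (opp (turn \<psi>)) + T (across (turn \<psi>)) * of_bool (4 \<le> S (across \<psi>)) / 2
        + T (opp (turn (slide \<psi>))) * of_bool (S (across \<psi>) = 4) / 2 \<le> 1"
      using half_edge_budget[OF assms, of f u e] \<psi> inv
      by (simp add: T_def S_def opp_def across_def turn_def slide_def of_bool_conj)
  qed (simp add: W_def)
  also have "\<dots> = (\<Sum>(f, v, a)\<in>flags. weight f)" by (intro sum.cong) (auto simp: W_def)
  finally show ?thesis .
qed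

text \<open>At a corner of a triangle the assumption \<open>heavy\<close> leaves 18 - 3 = 15 for the
  other three cells, and \<open>adjacent_triangle\<close> makes both neighbours there at least
  quadrilaterals. These are the hypotheses of \<open>triangle_charge\<close>.\<close>

lemma triangle_received:
  assumes "4 \<le> card N" "f \<in> F" "tri f"
    and heavy: "\<And>f v a b. \<lbrakk>f \<in> F; v \<in> V; incident v f; a \<in> N; b \<in> N; a \<noteq> b; v a = 0; v b = 0\<rbrakk>
      \<Longrightarrow> 18 \<le> cell_size f + cell_size (flip a f) + cell_size (flip b f) + cell_size (flip a (flip b f))"
  shows "1 \<le> (\<Sum>v\<in>corners f. \<Sum>a\<in>{a\<in>N. v a = 0}. received f v a)"
proof -
  obtain v where v: "v \<in> V" "incident v f" using cell_has_vertex[OF assms(2)] by auto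
  obtain a b where ab: "a \<in> N" "b \<in> N" "a \<noteq> b" "v a = 0" "v b = 0" using vertex_zeros[OF v(1)] by auto
  obtain c w z where c: "c \<in> N" "c \<noteq> a" "c \<noteq> b" "corners f = {v, w, z}" "v \<noteq> w" "v \<noteq> z" "w \<noteq> z"
    "w a = 0" "w c = 0" "z b = 0" "z c = 0"
    using triangle[OF assms(2,3) v ab] by (metis (no_types))
  have wz: "w \<in> V" "incident w f" "z \<in> V" "incident z f" using c(4) by (auto simp: corners_def)
  have corner: "(\<Sum>a\<in>{a\<in>N. v a = 0}. received f v a)
      = corner_charge (cell_size (flip a f)) (cell_size (flip b f)) (cell_size (flip a (flip b f)))"
    and sizes: "4 \<le> cell_size (flip a f)" "4 \<le> cell_size (flip b f)" "3 \<le> cell_size (flip a (flip b f))"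
      "15 \<le> cell_size (flip a f) + cell_size (flip b f) + cell_size (flip a (flip b f))"
    if "v \<in> V" "incident v f" "a \<in> N" "b \<in> N" "a \<noteq> b" "v a = 0" "v b = 0" for v a b
  proof -
    have o: "other_line v a = b" "other_line v b = a" using other_line_eqI that by auto
    show "(\<Sum>a\<in>{a\<in>N. v a = 0}. received f v a)
      = corner_charge (cell_size (flip a f)) (cell_size (flip b f)) (cell_size (flip a (flip b f)))"
      unfolding sum_lines_at_vertex[OF that(1,3-)] received_def o Let_def corner_charge_def
      by (simp add: flip_commute[of b a])
    show "4 \<le> cell_size (flip a f)" "4 \<le> cell_size (flip b f)"
      using adjacent_triangle[of f v a] adjacent_triangle[of f v b] that assms(1-3) by auto
    have "flip b f \<in> F" "incident v (flip b f)" using flip_cell[of f v b] incident_flip[of v f b] that assms(1-3) by auto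
    then have "flip a (flip b f) \<in> F" using flip_cell[of "flip b f" v a] that by auto
    then show "3 \<le> cell_size (flip a (flip b f))" by (rule cell_size_ge_3)
    show "15 \<le> cell_size (flip a f) + cell_size (flip b f) + cell_size (flip a (flip b f))"
      using heavy[of f v a b] that assms(1-3) by simp
  qed
  have "(\<Sum>v\<in>corners f. \<Sum>a\<in>{a\<in>N. v a = 0}. received f v a)
     = corner_charge (cell_size (flip a f)) (cell_size (flip b f)) (cell_size (flip a (flip b f)))
     + corner_charge (cell_size (flip b f)) (cell_size (flip c f)) (cell_size (flip b (flip c f)))
     + corner_charge (cell_size (flip a f)) (cell_size (flip c f)) (cell_size (flip a (flip c f)))"
    using c(2,3,5,6,7) corner[of v a b] corner[of z b c] corner[of w a c] v ab c wz by (simp add: c(4))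
  also have "\<dots> \<ge> 1"
    using sizes[of v a b] sizes[of z b c] sizes[of w a c] v ab c wz by (intro triangle_charge) auto
  finally show ?thesis .
qed

section \<open>Counting incidences; a vertex with small cells around it\<close>

lemma cells_at_vertex:
  assumes "v \<in> V" shows "card {f \<in> F. incident v f} \<le> 4"
proof -
  obtain a b where ab: "a \<in> N" "b \<in> N" "a \<noteq> b" "v a = 0" "v b = 0" using vertex_zeros[OF assms] by auto
  have "{f \<in> F. incident v f} \<subseteq> (\<lambda>(\<alpha>, \<beta>). v(a := \<alpha>, b := \<beta>)) ` ({1, -1} \<times> {1, -1})"
  proof
    fix f assume f: "f \<in> {f \<in> F. incident v f}"
    have "f n = (v(a := f a, b := f b)) n" for n
    proof (cases "n \<in> N \<and> n \<noteq> a \<and> n \<noteq> b")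
      case True
      then show ?thesis using vertex_nonzero[of v a b n] ab assms f by (auto simp: incidentD)
    next
      case False
      then show ?thesis using f ab assms cell_outside[of f n] vertex_outside[of v n] by auto
    qed
    then have "f = v(a := f a, b := f b)" by blast
    moreover have "(f a, f b) \<in> {1, -1} \<times> {1, -1}" using cell_range f ab by auto
    ultimately show "f \<in> (\<lambda>(\<alpha>, \<beta>). v(a := \<alpha>, b := \<beta>)) ` ({1, -1} \<times> {1, -1})"
      by (metis (mono_tags, lifting) case_prod_conv image_eqI)
  qed
  then have "card {f \<in> F. incident v f} \<le> card ((\<lambda>(\<alpha>, \<beta>). v(a := \<alpha>, b := \<beta>)) ` ({1, -1::real} \<times> {1, -1::real}))"
    by (intro card_mono) auto
  also have "\<dots> \<le> card ({1, -1::real} \<times> {1, -1::real})" by (intro card_image_le) auto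
  also have "\<dots> \<le> 4" by (simp add: card_cartesian_product card_insert_if)
  finally show ?thesis .
qed

lemma sum_cell_size: "(\<Sum>f\<in>F. cell_size f) \<le> 4 * card V"
proof -
  have "(\<Sum>f\<in>F. cell_size f) = (\<Sum>f\<in>F. \<Sum>v\<in>{v\<in>V. incident v f}. 1)"
    by (simp add: cell_size_def corners_def)
  also have "\<dots> = (\<Sum>v\<in>V. \<Sum>f\<in>{f\<in>F. incident v f}. 1)"
    using finite_F finite_V by (rule sum.swap_restrict)
  also have "\<dots> \<le> (\<Sum>v\<in>V. 4)" by (intro sum_mono) (use cells_at_vertex in simp)
  finally show ?thesis by simp
qed

text \<open>Otherwise the number of triangles is at most the total charge, which is the sum of size
  - 4 plus the number of triangles; then 4F is at most the sum of the sizes, hence at most 4V,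
  against \<open>euler\<close>. The bound 17 is 5 + 12.\<close>

lemma light_vertex:
  assumes "5 \<le> card N"
  shows "\<exists>f v a b. f \<in> F \<and> v \<in> V \<and> incident v f \<and> a \<in> N \<and> b \<in> N \<and> a \<noteq> b \<and> v a = 0 \<and> v b = 0
    \<and> cell_size f + cell_size (flip a f) + cell_size (flip b f) + cell_size (flip a (flip b f)) \<le> 17"
proof (rule ccontr)
  assume no: "\<not> ?thesis"
  have heavy: "18 \<le> cell_size f + cell_size (flip a f) + cell_size (flip b f) + cell_size (flip a (flip b f))"
    if "f \<in> F" "v \<in> V" "incident v f" "a \<in> N" "b \<in> N" "a \<noteq> b" "v a = 0" "v b = 0" for f v a b
  proof (rule ccontr)
    assume "\<not> ?thesis"
    then show False using no that by force
  qed
  have "(\<Sum>f\<in>F. of_bool (tri f)) \<le> (\<Sum>f\<in>F. of_bool (tri f) * (\<Sum>v\<in>corners f. \<Sum>a\<in>{a\<in>N. v a = 0}. received f v a))"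
    using triangle_received[OF _ _ _ heavy] assms by (intro sum_mono) auto
  also have "\<dots> = (\<Sum>(f, v, a)\<in>flags. of_bool (tri f) * received f v a)"
    by (simp add: sum_flags sum_distrib_left)
  also have "\<dots> \<le> (\<Sum>(f, v, a)\<in>flags. weight f)" by (rule received_le_weight[OF assms])
  also have "\<dots> = (\<Sum>f\<in>F. \<Sum>v\<in>corners f. 2 * weight f)"
  proof -
    have "(\<Sum>a\<in>{a\<in>N. v a = 0}. weight f) = 2 * weight f" if v: "v \<in> corners f" for v f
    proof -
      have "v \<in> V" using v by (simp add: corners_def)
      moreover from vertex_zeros[OF this] obtain a b where "a \<in> N" "b \<in> N" "a \<noteq> b" "v a = 0" "v b = 0" by auto
      ultimately show ?thesis using sum_lines_at_vertex[of v a b "\<lambda>_. weight f"] by simp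
    qed
    then show ?thesis unfolding sum_flags by (intro sum.cong refl)
  qed
  \<comment> \<open>A triangle pays nothing, and 0 = 3 - 4 + 1; larger cells pay their whole
    excess.\<close>
  also have "\<dots> = (\<Sum>f\<in>F. real (cell_size f) - 4 + of_bool (tri f))"
  proof (intro sum.cong refl)
    fix f assume "f \<in> F"
    then have "3 \<le> cell_size f" by (rule cell_size_ge_3)
    then show "(\<Sum>v\<in>corners f. 2 * weight f) = real (cell_size f) - 4 + of_bool (tri f)"
      by (cases "cell_size f = 3") (auto simp: cell_size_def[symmetric] half_charge_def max_def field_simps)
  qed
  also have "\<dots> = real (\<Sum>f\<in>F. cell_size f) - 4 * real (card F) + (\<Sum>f\<in>F. of_bool (tri f))"
    by (simp add: sum.distrib sum_subtractf)
  finally have "4 * real (card F) \<le> real (\<Sum>f\<in>F. cell_size f)" by linarith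
  also have "\<dots> \<le> real (4 * card V)" using sum_cell_size by (simp only: of_nat_le_iff)
  finally show False using euler by simp
qed

text \<open>The candidates for the vertices of the face around \<open>v\<close> once
  \<open>a\<close> and \<open>b\<close> are deleted: off both lines and nowhere strictly on the
  wrong side of another line.\<close>

definition visible :: "('a \<Rightarrow> real) \<Rightarrow> 'a \<Rightarrow> 'a \<Rightarrow> ('a \<Rightarrow> real) set" where
  "visible v a b = {w \<in> V. w a \<noteq> 0 \<and> w b \<noteq> 0 \<and> (\<forall>n\<in>N - {a, b}. w n \<noteq> 0 \<longrightarrow> w n = v n)}"

text \<open>The two signs of a visible vertex on \<open>a\<close> and \<open>b\<close> select one of
  the four cells at \<open>v\<close>, of which it is a corner.\<close>

lemma card_visible:
  assumes "f \<in> F" "v \<in> V" "incident v f" "a \<in> N" "b \<in> N" "a \<noteq> b" "v a = 0" "v b = 0"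
  shows "card (visible v a b) + 12
    \<le> cell_size f + cell_size (flip a f) + cell_size (flip b f) + cell_size (flip a (flip b f))"
proof -
  define far where "far g = {w \<in> corners g. \<not> (w a = 0 \<or> w b = 0)}" for g
  have far: "card (far g) + 3 = cell_size g" if "g \<in> F" "incident v g" for g
  proof -
    have "card {w \<in> corners g. w a = 0 \<or> w b = 0} = 3"
      using corners_near[of g v a b] that assms by (simp add: corners_def)
    moreover have "corners g = far g \<union> {w \<in> corners g. w a = 0 \<or> w b = 0}" by (auto simp: far_def)
    moreover have "card (far g \<union> {w \<in> corners g. w a = 0 \<or> w b = 0})
        = card (far g) + card {w \<in> corners g. w a = 0 \<or> w b = 0}"
      by (intro card_Un_disjoint) (auto simp: far_def)
    ultimately show ?thesis by (simp add: cell_size_def)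
  qed
  have fb: "flip b f \<in> F" "incident v (flip b f)" using flip_cell[of f v b] incident_flip[of v f b] assms by auto
  have fa: "flip a f \<in> F" "incident v (flip a f)" using flip_cell[of f v a] incident_flip[of v f a] assms by auto
  have fab: "flip a (flip b f) \<in> F" "incident v (flip a (flip b f))"
    using flip_cell[of "flip b f" v a] incident_flip[of v "flip b f" a] assms fb by auto
  have "visible v a b \<subseteq> far f \<union> far (flip a f) \<union> far (flip b f) \<union> far (flip a (flip b f))"
  proof
    fix w assume "w \<in> visible v a b"
    then have w: "w \<in> V" "w a \<noteq> 0" "w b \<noteq> 0" "\<And>n. n \<in> N \<Longrightarrow> n \<noteq> a \<Longrightarrow> n \<noteq> b \<Longrightarrow> w n \<noteq> 0 \<Longrightarrow> w n = v n"
      by (auto simp: visible_def)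
    have in_far: "w \<in> far g" if "\<And>n. n \<noteq> a \<Longrightarrow> n \<noteq> b \<Longrightarrow> g n = f n" "g a = w a" "g b = w b" for g
    proof -
      have "g n = w n" if "w n \<noteq> 0" for n
      proof (cases "n = a \<or> n = b")
        case False
        then have "n \<in> N" using vertex_outside[of w n] w that by auto
        then have "w n = v n" using w that False by auto
        then show ?thesis using incidentD[OF assms(3), of n] that False \<open>\<And>n. n \<noteq> a \<Longrightarrow> n \<noteq> b \<Longrightarrow> g n = f n\<close> by auto
      qed (use \<open>g a = w a\<close> \<open>g b = w b\<close> in auto)
      then show ?thesis using w by (simp add: far_def corners_def incident_def)
    qed
    have "w a = f a \<or> w a = - f a" "w b = f b \<or> w b = - f b"
      using vertex_range[OF w(1), of a] vertex_range[OF w(1), of b] w cell_range[of f a] cell_range[of f b] assms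
      by auto
    then show "w \<in> far f \<union> far (flip a f) \<union> far (flip b f) \<union> far (flip a (flip b f))"
      using in_far[of f] in_far[of "flip a f"] in_far[of "flip b f"] in_far[of "flip a (flip b f)"] assms(6)
      by auto
  qed
  then have "card (visible v a b) \<le> card (far f \<union> far (flip a f) \<union> far (flip b f) \<union> far (flip a (flip b f)))"
    by (intro card_mono) (auto simp: far_def)
  also have "\<dots> \<le> card (far f) + card (far (flip a f)) + card (far (flip b f)) + card (far (flip a (flip b f)))"
    by (meson add_mono card_Un_le le_trans order_refl)
  finally show ?thesis
    using far[OF assms(1,3)] far[OF fa] far[OF fb] far[OF fab] by linarith
qed

text \<open>With at most four lines, at most two of them miss \<open>v\<close>, so the visible
  vertices lie on the intersection of these two, an antipodal pair. From five lines on, discharging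
  applies.\<close>

lemma few_visible:
  "\<exists>v a b. v \<in> V \<and> a \<in> N \<and> b \<in> N \<and> a \<noteq> b \<and> v a = 0 \<and> v b = 0 \<and> card (visible v a b) \<le> 5"
proof (cases "5 \<le> card N")
  case True
  obtain f v a b where *: "f \<in> F" "v \<in> V" "incident v f" "a \<in> N" "b \<in> N" "a \<noteq> b" "v a = 0" "v b = 0"
    and "cell_size f + cell_size (flip a f) + cell_size (flip b f) + cell_size (flip a (flip b f)) \<le> 17"
    using light_vertex[OF True] by auto
  then have "card (visible v a b) \<le> 5" using card_visible[OF *] by linarith
  then show ?thesis using * by blast
next
  case False
  obtain f where "f \<in> F" using euler by fastforce
  then obtain v where v: "v \<in> V" using cell_has_vertex by blast
  obtain a b where ab: "a \<in> N" "b \<in> N" "a \<noteq> b" "v a = 0" "v b = 0" using vertex_zeros[OF v] by auto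
  have "card (visible v a b) \<le> 5"
  proof (cases "visible v a b = {}")
    case False
    then obtain w where w: "w \<in> V" "w a \<noteq> 0" "w b \<noteq> 0" by (auto simp: visible_def)
    have "visible v a b \<subseteq> {w, (\<lambda>n. - w n)}"
    proof
      fix u assume "u \<in> visible v a b"
      then have u: "u \<in> V" "u a \<noteq> 0" "u b \<noteq> 0" by (auto simp: visible_def)
      obtain c d where c: "c \<in> N" "d \<in> N" "c \<noteq> d" "w c = 0" "w d = 0" using vertex_zeros[OF w(1)] by auto
      obtain k l where k: "k \<in> N" "l \<in> N" "k \<noteq> l" "u k = 0" "u l = 0" using vertex_zeros[OF u(1)] by auto
      have "a \<noteq> c" "a \<noteq> d" "b \<noteq> c" "b \<noteq> d" using c w by auto
      then have "card {a, b, c, d} = 4" using ab(3) c(3) by simp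
      then have "N = {a, b, c, d}"
        using card_seteq[of N "{a, b, c, d}"] finite_N ab c \<open>\<not> 5 \<le> card N\<close> by auto
      then have "{k, l} = {c, d}" using k u by auto
      then have "u c = 0" "u d = 0" using k by (auto simp: doubleton_eq_iff)
      then show "u \<in> {w, (\<lambda>n. - w n)}" using vertex_unique[of w u c d] w u c by auto
    qed
    then have "card (visible v a b) \<le> card {w, (\<lambda>n. - w n)}" by (intro card_mono) auto
    also have "\<dots> \<le> 2" by (simp add: card_insert_if)
    finally show ?thesis by simp
  qed simp
  then show ?thesis using v ab by blast
qed

end

subsection \<open>Covectors of points in space\<close>

definition covector :: "(real^3) set \<Rightarrow> real^3 \<Rightarrow> real^3 \<Rightarrow> real" where
  "covector N x = (\<lambda>n. if n \<in> N then sgn (n \<bullet> x) else 0)"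

lemma covector_range: "covector N x n = 0 \<or> covector N x n = 1 \<or> covector N x n = -1"
  by (simp add: covector_def sgn_if)

lemma covector_scale: "0 < t \<Longrightarrow> covector N (t *\<^sub>R x) = covector N x"
  by (auto simp: covector_def fun_eq_iff sgn_mult)

lemma covector_scale_neg: "t < 0 \<Longrightarrow> covector N (t *\<^sub>R x) = (\<lambda>n. - covector N x n)"
  by (auto simp: covector_def fun_eq_iff sgn_mult)

lemma finite_covectors:
  assumes "finite N" shows "finite (covector N ` X)"
proof (rule finite_subset)
  show "covector N ` X \<subseteq> {g. \<forall>x. (x \<in> N \<longrightarrow> g x \<in> {0, 1, -1}) \<and> (x \<notin> N \<longrightarrow> g x = 0)}"
    by (auto simp: covector_def sgn_if split: if_splits)
  show "finite {g. \<forall>x. (x \<in> N \<longrightarrow> g x \<in> {0, 1, -1 :: real}) \<and> (x \<notin> N \<longrightarrow> g x = 0)}"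
    using assms by (intro finite_set_of_finite_funs) auto
qed

text \<open>Replaces the cross product, which would vanish for parallel \<open>a\<close> and
  \<open>b\<close>.\<close>

lemma common_orthogonal:
  fixes a b :: "real^3"
  obtains x where "x \<noteq> 0" "a \<bullet> x = 0" "b \<bullet> x = 0"
proof -
  have "dim {a, b} \<le> card {a, b}" by (rule dim_le_card) (auto intro: span_base)
  also have "\<dots> < DIM(real^3)" by (simp add: card_insert_if)
  finally obtain x where "x \<noteq> 0" and x: "\<And>y. y \<in> span {a, b} \<Longrightarrow> orthogonal x y"
    using orthogonal_to_subspace_exists by blast
  moreover have "a \<bullet> x = 0" "b \<bullet> x = 0"
    using x[of a] x[of b] by (auto simp: orthogonal_def span_base inner_commute)
  ultimately show ?thesis using that by blast
qed

section \<open>Moving points without changing signs, and counting regions\<close>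

lemma perturb_sgn:
  fixes x d :: "'b::real_inner"
  assumes "finite N"
  obtains \<epsilon> where "0 < \<epsilon>" "\<And>n. n \<in> N \<Longrightarrow> n \<bullet> x \<noteq> 0 \<Longrightarrow> sgn (n \<bullet> (x + \<epsilon> *\<^sub>R d)) = sgn (n \<bullet> x)"
proof -
  have "\<forall>\<^sub>F \<epsilon> in at_right 0. n \<bullet> x \<noteq> 0 \<longrightarrow> sgn (n \<bullet> (x + \<epsilon> *\<^sub>R d)) = sgn (n \<bullet> x)" for n
  proof (cases "n \<bullet> x = 0")
    case False
    have "((\<lambda>\<epsilon>. n \<bullet> (x + \<epsilon> *\<^sub>R d)) \<longlongrightarrow> n \<bullet> (x + 0 *\<^sub>R d)) (at_right 0)"
      by (intro tendsto_intros)
    then have lim: "((\<lambda>\<epsilon>. n \<bullet> (x + \<epsilon> *\<^sub>R d)) \<longlongrightarrow> n \<bullet> x) (at_right 0)" by simp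
    show ?thesis
    proof (cases "n \<bullet> x > 0")
      case True
      then show ?thesis using order_tendstoD(1)[OF lim True] by (auto elim!: eventually_mono)
    next
      case neg: False
      then have "n \<bullet> x < 0" using False by simp
      then show ?thesis using order_tendstoD(2)[OF lim, of 0] by (auto elim!: eventually_mono)
    qed
  qed simp
  then have "\<forall>\<^sub>F \<epsilon> in at_right 0. 0 < \<epsilon> \<and> (\<forall>n\<in>N. n \<bullet> x \<noteq> 0 \<longrightarrow> sgn (n \<bullet> (x + \<epsilon> *\<^sub>R d)) = sgn (n \<bullet> x))"
    using assms by (intro eventually_conj eventually_at_right_less) (auto intro: eventually_ball_finite)
  then obtain \<epsilon> where "0 < \<epsilon> \<and> (\<forall>n\<in>N. n \<bullet> x \<noteq> 0 \<longrightarrow> sgn (n \<bullet> (x + \<epsilon> *\<^sub>R d)) = sgn (n \<bullet> x))"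
    using eventually_happens'[OF trivial_limit_at_right_real] by blast
  then show ?thesis using that by blast
qed

text \<open>The points s x + e are followed as s decreases from infinity until one of the planes in K is met;
  unlike x + t e with t positive, they reach every plane.\<close>
lemma first_hit:
  fixes x e :: "'b::real_inner"
  assumes "finite K" "K \<noteq> {}" "\<And>k. k \<in> K \<Longrightarrow> k \<bullet> x \<noteq> 0"
  obtains M k\<^sub>0 where "k\<^sub>0 \<in> K" "k\<^sub>0 \<bullet> (M *\<^sub>R x + e) = 0"
    "\<And>k. k \<in> K \<Longrightarrow> k \<bullet> (M *\<^sub>R x + e) \<noteq> 0 \<Longrightarrow> sgn (k \<bullet> (M *\<^sub>R x + e)) = sgn (k \<bullet> x)"
    "M = Max ((\<lambda>k. - (k \<bullet> e) / (k \<bullet> x)) ` K)"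
proof -
  define s where "s k = - (k \<bullet> e) / (k \<bullet> x)" for k
  define M where "M = Max (s ` K)"
  have "M \<in> s ` K" unfolding M_def using assms by (intro Max_in) auto
  then obtain k\<^sub>0 where k0: "k\<^sub>0 \<in> K" "M = s k\<^sub>0" by blast
  have eq: "k \<bullet> (M *\<^sub>R x + e) = (k \<bullet> x) * (M - s k)" if "k \<in> K" for k
    using assms(3)[OF that] by (simp add: s_def inner_add_right field_simps)
  have ge: "0 \<le> M - s k" if "k \<in> K" for k
    using assms(1) that by (simp add: M_def)
  show ?thesis
  proof (rule that[OF k0(1)])
    show "k\<^sub>0 \<bullet> (M *\<^sub>R x + e) = 0" using eq[OF k0(1)] k0(2) by simp
    show "sgn (k \<bullet> (M *\<^sub>R x + e)) = sgn (k \<bullet> x)" if "k \<in> K" "k \<bullet> (M *\<^sub>R x + e) \<noteq> 0" for k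
    proof -
      have "0 < M - s k" using eq ge that by (metis less_eq_real_def mult_zero_right)
      then show ?thesis by (simp add: eq that sgn_mult)
    qed
    show "M = Max ((\<lambda>k. - (k \<bullet> e) / (k \<bullet> x)) ` K)" by (simp add: M_def s_def)
  qed
qed

text \<open>The sign patterns of the regions that the planes of \<open>N\<close> cut out of the
  subspace orthogonal to \<open>M\<close>. Carrying \<open>M\<close> along lets the induction pass
  to a plane and to a line inside space.\<close>

definition slice :: "(real^3) set \<Rightarrow> (real^3) set \<Rightarrow> (real^3 \<Rightarrow> real) set" where
  "slice M N = covector N ` {x. (\<forall>m\<in>M. m \<bullet> x = 0) \<and> (\<forall>n\<in>N. n \<bullet> x \<noteq> 0)}"

lemma finite_slice: "finite N \<Longrightarrow> finite (slice M N)"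
  unfolding slice_def by (rule finite_covectors)

lemma covector_insert:
  "l \<notin> N \<Longrightarrow> covector (insert l N) x = (covector N x)(l := sgn (l \<bullet> x))"
  by (auto simp: covector_def fun_eq_iff)

text \<open>Deletion and restriction: a covector of the restriction to l extends to both sides of l.\<close>
lemma card_slice_insert:
  assumes "finite N" "l \<notin> N" and d: "\<forall>m\<in>M. m \<bullet> d = 0" "l \<bullet> d \<noteq> 0"
  shows "card (slice M N) + card (slice (insert l M) N) \<le> card (slice M (insert l N))"
proof -
  \<comment> \<open>\<open>P \<sigma>\<close> collects the patterns of \<open>N\<close> that occur
    on side \<open>\<sigma>\<close> of \<open>l\<close>. All patterns lie in the union of
    \<open>P 1\<close> and \<open>P (-1)\<close>, those of the restriction to \<open>l\<close> in
    the intersection, and union and intersection together have as many elements as the two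
    sets.\<close>
  define P where "P \<sigma> = {g \<in> slice M N. g(l := \<sigma>) \<in> slice M (insert l N)}" for \<sigma> :: real
  have fin: "finite (slice M N)" "finite (slice M (insert l N))" "finite (P \<sigma>)" for \<sigma>
    using assms(1) by (auto simp: finite_slice P_def)
  have both: "g \<in> P 1 \<inter> P (-1)" if "g \<in> slice (insert l M) N" for g
  proof -
    obtain x where x: "\<forall>m\<in>insert l M. m \<bullet> x = 0" "\<forall>n\<in>N. n \<bullet> x \<noteq> 0" "g = covector N x"
      using \<open>g \<in> slice (insert l M) N\<close> by (auto simp: slice_def)
    have "g(l := \<sigma>) \<in> slice M (insert l N)" if "\<sigma> = 1 \<or> \<sigma> = -1" for \<sigma>
    proof -
      define d' where "d' = (\<sigma> / (l \<bullet> d)) *\<^sub>R d"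
      have d': "\<forall>m\<in>M. m \<bullet> d' = 0" "l \<bullet> d' = \<sigma>" using d by (auto simp: d'_def)
      obtain \<epsilon> where \<epsilon>: "0 < \<epsilon>" "\<And>n. n \<in> N \<Longrightarrow> n \<bullet> x \<noteq> 0 \<Longrightarrow> sgn (n \<bullet> (x + \<epsilon> *\<^sub>R d')) = sgn (n \<bullet> x)"
        using perturb_sgn[OF assms(1)] by blast
      define y where "y = x + \<epsilon> *\<^sub>R d'"
      have sg: "sgn (n \<bullet> y) = sgn (n \<bullet> x)" if "n \<in> N" for n using \<epsilon>(2) x(2) that by (simp add: y_def)
      have ly: "sgn (l \<bullet> y) = \<sigma>" using x(1) d' \<epsilon>(1) \<open>\<sigma> = 1 \<or> \<sigma> = -1\<close> by (auto simp: y_def inner_add_right sgn_mult)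
      have "g(l := \<sigma>) = covector (insert l N) y"
        using assms(2) sg ly x(3) by (auto simp: covector_def fun_eq_iff)
      moreover have "\<forall>m\<in>M. m \<bullet> y = 0" using x(1) d' by (simp add: y_def inner_add_right)
      moreover have "\<forall>n\<in>insert l N. n \<bullet> y \<noteq> 0" using sg ly x(2) \<open>\<sigma> = 1 \<or> \<sigma> = -1\<close>
        by (metis insert_iff sgn_zero_iff zero_neq_neg_one zero_neq_one)
      ultimately show ?thesis by (auto simp: slice_def)
    qed
    moreover have "g \<in> slice M N" using x by (auto simp: slice_def)
    ultimately show ?thesis by (auto simp: P_def)
  qed
  have "slice M N \<subseteq> P 1 \<union> P (-1)"
  proof
    fix g assume g: "g \<in> slice M N"
    then obtain x where x: "\<forall>m\<in>M. m \<bullet> x = 0" "\<forall>n\<in>N. n \<bullet> x \<noteq> 0" "g = covector N x"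
      by (auto simp: slice_def)
    show "g \<in> P 1 \<union> P (-1)"
    proof (cases "l \<bullet> x = 0")
      case True
      then have "g \<in> slice (insert l M) N" using x by (auto simp: slice_def)
      then show ?thesis using both by blast
    next
      case False
      have "covector (insert l N) x \<in> slice M (insert l N)" using x False by (auto simp: slice_def)
      then have "g(l := sgn (l \<bullet> x)) \<in> slice M (insert l N)" using covector_insert assms(2) x by simp
      then show ?thesis using g False by (auto simp: P_def sgn_if split: if_splits)
    qed
  qed
  then have "card (slice M N) \<le> card (P 1 \<union> P (-1))" using fin by (intro card_mono) auto
  moreover have "card (slice (insert l M) N) \<le> card (P 1 \<inter> P (-1))" using fin both by (intro card_mono) auto
  moreover have "card (P 1 \<union> P (-1)) + card (P 1 \<inter> P (-1)) = card (P 1) + card (P (-1))"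
    using card_Un_Int[OF fin(3) fin(3)] by simp
  moreover have "card (P 1) + card (P (-1)) = card ((\<lambda>g. g(l := 1)) ` P 1 \<union> (\<lambda>g. g(l := -1)) ` P (-1))"
  proof -
    have zero: "g l = 0" if "g \<in> P \<sigma>" for g \<sigma> using that assms(2) by (auto simp: P_def slice_def covector_def)
    have "inj_on (\<lambda>g. g(l := \<tau>)) (P \<sigma>)" for \<sigma> \<tau>
    proof (rule inj_onI)
      fix g h assume gh: "g \<in> P \<sigma>" "h \<in> P \<sigma>" "g(l := \<tau>) = h(l := \<tau>)"
      have "g n = h n" for n
        using fun_cong[OF gh(3), of n] zero[OF gh(1)] zero[OF gh(2)] by (cases "n = l") auto
      then show "g = h" by blast
    qed
    then have "card ((\<lambda>g. g(l := \<tau>)) ` P \<sigma>) = card (P \<sigma>)" for \<sigma> \<tau> by (rule card_image)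
    moreover have "(\<lambda>g. g(l := 1)) ` P 1 \<inter> (\<lambda>g. g(l := -1)) ` P (-1) = {}"
      by (auto simp: fun_upd_eqD dest: fun_cong[of _ _ l])
    ultimately show ?thesis using fin by (subst card_Un_disjoint) auto
  qed
  moreover have "\<dots> \<le> card (slice M (insert l N))"
    using fin by (intro card_mono) (auto simp: P_def)
  ultimately show ?thesis by linarith
qed

subsection \<open>Arrangements given by normals in general position\<close>

locale generic_normals =
  fixes N :: "(real^3) set"
  assumes finite_N: "finite N" and card_N: "3 \<le> card N"
    and generic: "\<lbrakk>a \<in> N; b \<in> N; c \<in> N; a \<noteq> b; a \<noteq> c; b \<noteq> c; a \<bullet> x = 0; b \<bullet> x = 0; c \<bullet> x = 0\<rbrakk> \<Longrightarrow> x = 0"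
begin

definition vertices :: "(real^3 \<Rightarrow> real) set" where
  "vertices = covector N ` {x. x \<noteq> 0 \<and> (\<exists>a\<in>N. \<exists>b\<in>N. a \<noteq> b \<and> a \<bullet> x = 0 \<and> b \<bullet> x = 0)}"

definition cells :: "(real^3 \<Rightarrow> real) set" where
  "cells = covector N ` {x. \<forall>n\<in>N. n \<bullet> x \<noteq> 0}"

lemma covector_zero_iff: "n \<in> N \<Longrightarrow> covector N x n = 0 \<longleftrightarrow> n \<bullet> x = 0"
  by (simp add: covector_def sgn_zero_iff)

lemma third_normal:
  obtains c where "c \<in> N" "c \<noteq> a" "c \<noteq> b"
proof -
  have "\<not> N \<subseteq> {a, b}"
  proof
    assume "N \<subseteq> {a, b}"
    then have "card N \<le> card {a, b}" by (intro card_mono) auto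
    also have "\<dots> \<le> 2" by (simp add: card_insert_if)
    finally show False using card_N by simp
  qed
  then show ?thesis using that by blast
qed

lemma separating:
  assumes "a \<in> N" "b \<in> N" "a \<noteq> b"
  obtains d where "a \<bullet> d = 0" "b \<bullet> d \<noteq> 0"
proof -
  obtain c where c: "c \<in> N" "c \<noteq> a" "c \<noteq> b" by (rule third_normal)
  obtain d where d: "d \<noteq> 0" "a \<bullet> d = 0" "c \<bullet> d = 0" by (rule common_orthogonal)
  then have "b \<bullet> d \<noteq> 0" using generic[of a b c d] c assms by auto
  then show ?thesis using that d by blast
qed

lemma proportional:
  assumes "a \<in> N" "b \<in> N" "a \<noteq> b" "x \<noteq> 0" "a \<bullet> x = 0" "b \<bullet> x = 0" "a \<bullet> y = 0" "b \<bullet> y = 0"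
  obtains t where "y = t *\<^sub>R x"
proof -
  obtain c where c: "c \<in> N" "c \<noteq> a" "c \<noteq> b" by (rule third_normal)
  have cx: "c \<bullet> x \<noteq> 0" using generic[of a b c x] c assms by auto
  define t where "t = (c \<bullet> y) / (c \<bullet> x)"
  have "y - t *\<^sub>R x = 0"
    using generic[of a b c "y - t *\<^sub>R x"] c assms cx by (simp add: inner_diff_right t_def)
  then have "y = t *\<^sub>R x" by simp
  then show ?thesis by (rule that)
qed

lemma covectors_on_two:
  assumes "a \<in> N" "b \<in> N" "a \<noteq> b" "x \<noteq> 0" "a \<bullet> x = 0" "b \<bullet> x = 0" "y \<noteq> 0" "a \<bullet> y = 0" "b \<bullet> y = 0"
  shows "covector N y = covector N x \<or> covector N y = (\<lambda>n. - covector N x n)"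
proof -
  obtain t where t: "y = t *\<^sub>R x" using proportional[of a b x y] assms by blast
  then have "0 < t \<or> t < 0" using assms by (cases t "0::real" rule: linorder_cases) auto
  then show ?thesis using t covector_scale covector_scale_neg by blast
qed

lemma vertexE:
  assumes "v \<in> vertices"
  obtains x a b where "v = covector N x" "x \<noteq> 0" "a \<in> N" "b \<in> N" "a \<noteq> b" "a \<bullet> x = 0" "b \<bullet> x = 0"
  using assms unfolding vertices_def by blast

lemma vertexI:
  assumes "x \<noteq> 0" "a \<in> N" "b \<in> N" "a \<noteq> b" "a \<bullet> x = 0" "b \<bullet> x = 0"
  shows "covector N x \<in> vertices"
  using assms unfolding vertices_def by blast

lemma incident_covector:
  "(\<And>n. n \<in> N \<Longrightarrow> n \<bullet> x \<noteq> 0 \<Longrightarrow> sgn (n \<bullet> x) = g n) \<Longrightarrow> incident (covector N x) g"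
  by (auto simp: incident_def covector_def sgn_zero_iff)

section \<open>The covector axioms for points in space\<close>

lemma cell_at_vertex:
  assumes "v \<in> vertices" "a \<in> N" "b \<in> N" "a \<noteq> b" "v a = 0" "v b = 0"
    "\<alpha> = 1 \<or> \<alpha> = -1" "\<beta> = 1 \<or> \<beta> = -1"
  shows "v(a := \<alpha>, b := \<beta>) \<in> cells"
proof -
  obtain x where x: "v = covector N x" "x \<noteq> 0" using assms(1) by (rule vertexE)
  have ab: "a \<bullet> x = 0" "b \<bullet> x = 0" using assms x covector_zero_iff by auto
  obtain p where p: "a \<bullet> p = 0" "b \<bullet> p \<noteq> 0" using separating[of a b] assms by blast
  obtain q where q: "b \<bullet> q = 0" "a \<bullet> q \<noteq> 0" using separating[of b a] assms by blast
  \<comment> \<open>\<open>p\<close> lies in the plane of \<open>a\<close> but not of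
    \<open>b\<close>, and \<open>q\<close> the other way round, so the products with
    \<open>a\<close> and \<open>b\<close> can be prescribed independently.\<close>
  define d where "d = (\<beta> / (b \<bullet> p)) *\<^sub>R p + (\<alpha> / (a \<bullet> q)) *\<^sub>R q"
  have d: "a \<bullet> d = \<alpha>" "b \<bullet> d = \<beta>" using p q by (simp_all add: d_def inner_add_right)
  obtain \<epsilon> where \<epsilon>: "0 < \<epsilon>" "\<And>n. n \<in> N \<Longrightarrow> n \<bullet> x \<noteq> 0 \<Longrightarrow> sgn (n \<bullet> (x + \<epsilon> *\<^sub>R d)) = sgn (n \<bullet> x)"
    using perturb_sgn[OF finite_N] by blast
  define y where "y = x + \<epsilon> *\<^sub>R d"
  have nz: "n \<bullet> x \<noteq> 0" if "n \<in> N" "n \<noteq> a" "n \<noteq> b" for n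
    using generic[of a b n x] assms ab x that by auto
  have sg: "sgn (n \<bullet> y) = (v(a := \<alpha>, b := \<beta>)) n" if "n \<in> N" for n
    using that \<epsilon> ab d nz assms(4,7,8) x(1) by (auto simp: y_def inner_add_right sgn_mult covector_def)
  then have "v(a := \<alpha>, b := \<beta>) = covector N y"
    using assms x(1) by (auto simp: covector_def fun_eq_iff)
  moreover have "n \<bullet> y \<noteq> 0" if "n \<in> N" for n
  proof -
    have "(v(a := \<alpha>, b := \<beta>)) n \<noteq> 0" using nz[OF that] that assms x covector_zero_iff[of n x] by auto
    then show ?thesis using sg[OF that] by (metis sgn_zero_iff)
  qed
  ultimately show ?thesis by (auto simp: cells_def)
qed

text \<open>A point of the cell is moved to a plane \<open>l\<close> and, if no second plane passes
  through the point reached, moved on inside \<open>l\<close>. The offset \<open>e\<close> is a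
  nonzero vector in a plane that the starting point avoids, so the end point cannot be 0;
  \<open>e'\<close> plays this role inside \<open>l\<close>.\<close>

lemma cell_has_vertex:
  assumes "f \<in> cells" shows "\<exists>v\<in>vertices. incident v f"
proof -
  obtain y where y: "f = covector N y" "\<And>n. n \<in> N \<Longrightarrow> n \<bullet> y \<noteq> 0" using assms by (auto simp: cells_def)
  have sf: "f n = sgn (n \<bullet> y)" if "n \<in> N" for n using y that by (simp add: covector_def)
  obtain a where a: "a \<in> N" using third_normal by blast
  obtain e where e: "e \<noteq> 0" "a \<bullet> e = 0" using common_orthogonal[of a a] by blast
  obtain M l where l: "l \<in> N" "l \<bullet> (M *\<^sub>R y + e) = 0"
    "\<And>k. k \<in> N \<Longrightarrow> k \<bullet> (M *\<^sub>R y + e) \<noteq> 0 \<Longrightarrow> sgn (k \<bullet> (M *\<^sub>R y + e)) = sgn (k \<bullet> y)"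
    "M = Max ((\<lambda>k. - (k \<bullet> e) / (k \<bullet> y)) ` N)"
    by (rule first_hit[OF finite_N _ y(2)]) (use a in auto)
  define w where "w = M *\<^sub>R y + e"
  have w0: "w \<noteq> 0"
  proof
    assume "w = 0"
    then have "M * (a \<bullet> y) = 0" using e by (metis w_def inner_add_right inner_scaleR_right inner_zero_right add_0_right)
    then have "M = 0" using y(2) a by simp
    then show False using \<open>w = 0\<close> e by (simp add: w_def)
  qed
  have w: "l \<bullet> w = 0" "\<And>k. k \<in> N \<Longrightarrow> k \<bullet> w \<noteq> 0 \<Longrightarrow> sgn (k \<bullet> w) = f k" using l sf by (auto simp: w_def)
  show ?thesis
  proof (cases "\<exists>m\<in>N. m \<noteq> l \<and> m \<bullet> w = 0")
    case True
    then have "covector N w \<in> vertices" using w0 w l by (auto intro: vertexI)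
    moreover have "incident (covector N w) f" using w by (intro incident_covector) auto
    ultimately show ?thesis by blast
  next
    case False
    define K where "K = N - {l}"
    have K: "finite K" "\<And>k. k \<in> K \<Longrightarrow> k \<bullet> w \<noteq> 0" using False finite_N by (auto simp: K_def)
    obtain c where c: "c \<in> K" using third_normal[of l l] by (auto simp: K_def)
    obtain e' where e': "e' \<noteq> 0" "l \<bullet> e' = 0" "c \<bullet> e' = 0" by (rule common_orthogonal)
    obtain M' m where m: "m \<in> K" "m \<bullet> (M' *\<^sub>R w + e') = 0"
      "\<And>k. k \<in> K \<Longrightarrow> k \<bullet> (M' *\<^sub>R w + e') \<noteq> 0 \<Longrightarrow> sgn (k \<bullet> (M' *\<^sub>R w + e')) = sgn (k \<bullet> w)"
      "M' = Max ((\<lambda>k. - (k \<bullet> e') / (k \<bullet> w)) ` K)"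
      by (rule first_hit[OF K(1) _ K(2)]) (use c in auto)
    define z where "z = M' *\<^sub>R w + e'"
    have "z \<noteq> 0"
    proof
      assume "z = 0"
      then have "M' * (c \<bullet> w) = 0" using e' by (metis z_def inner_add_right inner_scaleR_right inner_zero_right add_0_right)
      then have "M' = 0" using K c by simp
      then show False using \<open>z = 0\<close> e' by (simp add: z_def)
    qed
    moreover have lz: "l \<bullet> z = 0" using w e' by (simp add: z_def inner_add_right)
    ultimately have "covector N z \<in> vertices" using m l by (intro vertexI[of z l m]) (auto simp: z_def K_def)
    moreover have "incident (covector N z) f"
    proof (rule incident_covector)
      fix n assume n: "n \<in> N" "n \<bullet> z \<noteq> 0"
      then have "n \<in> K" using lz by (auto simp: K_def)
      then show "sgn (n \<bullet> z) = f n" using m(3) n w(2) K(2) by (simp add: z_def)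
    qed
    ultimately show ?thesis by blast
  qed
qed

text \<open>Up to a positive factor, the points of the plane of \<open>a\<close> on the cell's side
  of \<open>b\<close> are \<open>t *\<^sub>R x + e\<close> with \<open>b \<bullet> e = f b\<close>.
  Along this line the edge ends at the largest \<open>t\<close> at which a further plane is met, and
  a maximum is unique.\<close>

lemma edge:
  assumes "f \<in> cells" "v \<in> vertices" "incident v f" "a \<in> N" "v a = 0"
  shows "\<exists>!w. w \<in> vertices \<and> incident w f \<and> w a = 0 \<and> w \<noteq> v"
proof -
  obtain x a' b' where x: "v = covector N x" "x \<noteq> 0" "a' \<in> N" "b' \<in> N" "a' \<noteq> b'" "a' \<bullet> x = 0" "b' \<bullet> x = 0"
    using assms(2) by (rule vertexE)
  have ax: "a \<bullet> x = 0" using assms x covector_zero_iff by auto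
  then obtain b where b: "b \<in> N" "b \<noteq> a" "b \<bullet> x = 0" using x by metis
  have fne: "f n \<noteq> 0" if "n \<in> N" for n using assms(1) that by (auto simp: cells_def covector_def sgn_zero_iff)
  have fsg: "sgn (f n) = f n" for n using assms(1) by (auto simp: cells_def covector_def)
  obtain d where d: "a \<bullet> d = 0" "b \<bullet> d \<noteq> 0" using separating[of a b] assms b by blast
  define e where "e = (f b / (b \<bullet> d)) *\<^sub>R d"
  have e: "a \<bullet> e = 0" "b \<bullet> e = f b" using d by (auto simp: e_def)
  define K where "K = N - {a, b}"
  obtain c where c: "c \<in> K" using third_normal[of a b] by (auto simp: K_def)
  have K: "finite K" "K \<noteq> {}" using finite_N c by (auto simp: K_def)
  have kx: "k \<bullet> x \<noteq> 0" if "k \<in> K" for k using generic[of a b k x] ax b x(2) assms that by (auto simp: K_def)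
  have fk: "f k = sgn (k \<bullet> x)" if "k \<in> K" for k
    using incidentD[OF assms(3), of k] kx[OF that] that by (simp add: x(1) covector_def K_def sgn_zero_iff)
  obtain M k\<^sub>0 where k0: "k\<^sub>0 \<in> K" "k\<^sub>0 \<bullet> (M *\<^sub>R x + e) = 0"
    and ksg: "\<And>k. k \<in> K \<Longrightarrow> k \<bullet> (M *\<^sub>R x + e) \<noteq> 0 \<Longrightarrow> sgn (k \<bullet> (M *\<^sub>R x + e)) = sgn (k \<bullet> x)"
    and M: "M = Max ((\<lambda>k. - (k \<bullet> e) / (k \<bullet> x)) ` K)"
    by (rule first_hit[OF K kx, where e = e]) auto
  define y where "y = M *\<^sub>R x + e"
  have ay: "a \<bullet> y = 0" and bye: "b \<bullet> y = f b" using ax b e by (auto simp: y_def inner_add_right)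
  have by0: "b \<bullet> y \<noteq> 0" using bye fne b by simp
  show ?thesis
  proof (rule ex1I[of _ "covector N y"])
    have "covector N y \<in> vertices" using by0 ay k0 assms by (intro vertexI[of y a k\<^sub>0]) (auto simp: K_def y_def)
    moreover have "incident (covector N y) f"
    proof (rule incident_covector)
      fix n assume n: "n \<in> N" "n \<bullet> y \<noteq> 0"
      then consider "n = b" | "n \<in> K" using ay by (auto simp: K_def)
      then show "sgn (n \<bullet> y) = f n"
        by cases (use bye fsg fk ksg n in \<open>auto simp: y_def\<close>)
    qed
    moreover have "covector N y \<noteq> v" using by0 b covector_zero_iff[of b] x(1) by metis
    ultimately show "covector N y \<in> vertices \<and> incident (covector N y) f \<and> covector N y a = 0 \<and> covector N y \<noteq> v"
      using ay assms covector_zero_iff by auto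
  next
    fix w assume w: "w \<in> vertices \<and> incident w f \<and> w a = 0 \<and> w \<noteq> v"
    then obtain z p q where z: "w = covector N z" "z \<noteq> 0" "p \<in> N" "q \<in> N" "p \<noteq> q" "p \<bullet> z = 0" "q \<bullet> z = 0"
      using vertexE by blast
    have az: "a \<bullet> z = 0" using w z assms covector_zero_iff by auto
    have wsg: "sgn (n \<bullet> z) = f n" if "n \<in> N" "n \<bullet> z \<noteq> 0" for n
      using w incidentD[of w f n] that by (simp add: z(1) covector_def sgn_zero_iff)
    have bz: "b \<bullet> z \<noteq> 0"
    proof
      assume "b \<bullet> z = 0"
      then have "w = (\<lambda>n. - v n)" using covectors_on_two[of a b x z] w x z ax az b assms by auto
      moreover have "v c \<noteq> 0" using kx[OF c] c covector_zero_iff[of c x] x(1) by (auto simp: K_def)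
      ultimately show False using incidentD[of v f c] incidentD[of w f c] w assms(3) by auto
    qed
    \<comment> \<open>With this factor, z / r and \<open>e\<close> have the same products with
      \<open>a\<close> and \<open>b\<close>, so they differ by a multiple of
      \<open>x\<close>.\<close>
    define r where "r = (b \<bullet> z) / f b"
    have r: "0 < r" using wsg[of b] bz b fne[of b] by (auto simp: r_def sgn_if zero_less_divide_iff split: if_splits)
    obtain t where t: "(1 / r) *\<^sub>R z - e = t *\<^sub>R x"
      using proportional[of a b x "(1 / r) *\<^sub>R z - e"] assms b ax x(2) az e fne[of b] bz
      by (auto simp: inner_diff_right r_def)
    then have z': "z = r *\<^sub>R (t *\<^sub>R x + e)" using r by (simp add: algebra_simps flip: t)
    have kz: "k \<bullet> z = r * (k \<bullet> x) * (t - (- (k \<bullet> e) / (k \<bullet> x)))" if "k \<in> K" for k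
      using kx[OF that] unfolding z' by (simp add: inner_add_right field_simps)
    \<comment> \<open>Incidence puts \<open>t\<close> above all hitting parameters, and a second
      plane through \<open>z\<close> makes it equal to one of them; so \<open>t\<close> is the
      maximum.\<close>
    have le: "- (k \<bullet> e) / (k \<bullet> x) \<le> t" if "k \<in> K" for k
    proof (rule ccontr)
      assume "\<not> ?thesis"
      then have lt: "t - (- (k \<bullet> e) / (k \<bullet> x)) < 0" by simp
      then have "sgn (k \<bullet> z) = - sgn (k \<bullet> x)" using r kz[OF that] by (simp add: sgn_mult)
      moreover have "k \<bullet> z \<noteq> 0" using calculation kx[OF that] by (metis neg_equal_0_iff_equal sgn_zero_iff)
      ultimately show False using wsg[of k] fk[OF that] that kx[OF that] by (simp add: K_def sgn_zero_iff)
    qed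
    obtain k where k: "k \<in> K" "k \<bullet> z = 0"
    proof -
      obtain k where "k \<in> N" "k \<noteq> a" "k \<bullet> z = 0" using z by metis
      then show ?thesis using that bz by (auto simp: K_def)
    qed
    then have "t = - (k \<bullet> e) / (k \<bullet> x)" using kz[OF k(1)] r kx[OF k(1)] by simp
    then have "M = t" unfolding M using K le k(1) by (intro Max_eqI) auto
    then show "w = covector N y" using z' z(1) covector_scale[OF r] by (simp add: y_def)
  qed
qed

section \<open>Cells outnumber vertices\<close>

lemma card_slice_2:
  assumes "u \<in> N" "m \<in> N" "u \<noteq> m" "K \<subseteq> N - {u, m}"
  shows "1 \<le> card (slice {u, m} K)" "K \<noteq> {} \<Longrightarrow> 2 \<le> card (slice {u, m} K)"
proof -
  obtain x where x: "x \<noteq> 0" "u \<bullet> x = 0" "m \<bullet> x = 0" by (rule common_orthogonal)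
  have nz: "k \<bullet> x \<noteq> 0" if "k \<in> K" for k using generic[of u m k x] assms x that by auto
  have fin: "finite (slice {u, m} K)" using finite_subset[OF assms(4)] finite_N by (intro finite_slice) auto
  have sub: "{covector K x, covector K (- x)} \<subseteq> slice {u, m} K"
    unfolding slice_def using x nz by (auto intro!: imageI)
  show "1 \<le> card (slice {u, m} K)" using sub fin by (auto simp: Suc_le_eq card_gt_0_iff)
  show "2 \<le> card (slice {u, m} K)" if "K \<noteq> {}"
  proof -
    obtain k where "k \<in> K" using \<open>K \<noteq> {}\<close> by blast
    then have "covector K x k \<noteq> covector K (- x) k" using nz by (auto simp: covector_def sgn_if)
    then have "card {covector K x, covector K (- x)} = 2" by (metis card_2_iff)
    then show ?thesis using card_mono[OF fin sub] by simp
  qed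
qed

text \<open>In a plane each new line through the origin adds two regions. The clause with 1 carries
  the start of the induction, where there is one region although twice the number of lines is
  0.\<close>

lemma card_slice_1:
  assumes "u \<in> N" "K \<subseteq> N - {u}"
  shows "1 \<le> card (slice {u} K) \<and> 2 * card K \<le> card (slice {u} K)"
proof -
  have "finite K" using finite_subset[OF assms(2)] finite_N by auto
  then show ?thesis using assms(2)
  proof (induction K)
    case empty
    have "covector {} u \<in> slice {u} {}" unfolding slice_def covector_def
      by (rule image_eqI[of _ _ 0]) auto
    then have "slice {u} {} \<noteq> {}" by blast
    then show ?case using finite_slice[of "{}" "{u}"] by (simp add: Suc_le_eq card_gt_0_iff)
  next
    case (insert m K)
    then have m: "m \<in> N" "m \<noteq> u" "K \<subseteq> N - {u, m}" by auto
    obtain d where d: "u \<bullet> d = 0" "m \<bullet> d \<noteq> 0" using separating[of u m] assms m by auto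
    have "card (slice {u} K) + card (slice {u, m} K) \<le> card (slice {u} (insert m K))"
      using card_slice_insert[of K m "{u}" d] insert d by (simp add: insert_commute)
    moreover have "1 \<le> card (slice {u, m} K)" "K \<noteq> {} \<Longrightarrow> 2 \<le> card (slice {u, m} K)"
      using card_slice_2[of u m K] assms m by auto
    ultimately show ?case using insert by (cases "K = {}") auto
  qed
qed

text \<open>A new plane is cut by the k old ones into at least 2k sectors, each splitting a region,
  and k(k - 1) + 2 + 2k = (k + 1)k + 2.\<close>

lemma card_slice_0:
  assumes "K \<subseteq> N"
  shows "1 \<le> card (slice {} K) \<and> (K \<noteq> {} \<longrightarrow> card K * (card K - 1) + 2 \<le> card (slice {} K))"
proof -
  have "finite K" using finite_subset[OF assms] finite_N by auto
  then show ?thesis using assms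
  proof (induction K)
    case empty
    have "slice {} {} \<noteq> {}" unfolding slice_def by auto
    then show ?case using finite_slice[of "{}" "{}"] by (simp add: Suc_le_eq card_gt_0_iff)
  next
    case (insert l K)
    then have l: "l \<in> N" "K \<subseteq> N - {l}" by auto
    obtain a where "a \<in> N" "a \<noteq> l" by (rule third_normal)
    then obtain d where d: "l \<bullet> d \<noteq> 0" using separating[of a l] l by auto
    have "card (slice {} K) + card (slice {l} K) \<le> card (slice {} (insert l K))"
      using card_slice_insert[of K l "{}" d] insert d by simp
    moreover have "1 \<le> card (slice {l} K) \<and> 2 * card K \<le> card (slice {l} K)"
      using card_slice_1[of l K] l by auto
    ultimately show ?case using insert
      by (cases "card K") (auto simp: algebra_simps)
  qed
qed

text \<open>Each pair of planes meets in a line, whose two rays give two opposite covectors; twice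
  the number of pairs is the bound.\<close>

lemma card_vertices: "card vertices \<le> card N * (card N - 1)"
proof -
  define pairs where "pairs = {B. B \<subseteq> N \<and> card B = 2}"
  define on where "on B = {v \<in> vertices. \<forall>n\<in>B. v n = 0}" for B
  have fin: "finite pairs" "finite vertices" "finite (on B)" for B
    using finite_N finite_covectors[OF finite_N] by (auto simp: pairs_def vertices_def on_def)
  have "vertices \<subseteq> (\<Union>B\<in>pairs. on B)"
  proof
    fix v assume v: "v \<in> vertices"
    then obtain x a b where x: "v = covector N x" "a \<in> N" "b \<in> N" "a \<noteq> b" "a \<bullet> x = 0" "b \<bullet> x = 0"
      by (metis vertexE)
    then have "{a, b} \<in> pairs" "v \<in> on {a, b}" using v covector_zero_iff by (auto simp: pairs_def on_def)
    then show "v \<in> (\<Union>B\<in>pairs. on B)" by blast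
  qed
  then have "card vertices \<le> card (\<Union>B\<in>pairs. on B)" using fin by (intro card_mono) auto
  also have "\<dots> \<le> (\<Sum>B\<in>pairs. card (on B))" using fin by (intro card_UN_le)
  also have "\<dots> \<le> (\<Sum>B\<in>pairs. 2)"
  proof (rule sum_mono)
    fix B assume "B \<in> pairs"
    then obtain a b where ab: "B = {a, b}" "a \<noteq> b" "a \<in> N" "b \<in> N" by (auto simp: pairs_def card_2_iff)
    obtain x where x: "x \<noteq> 0" "a \<bullet> x = 0" "b \<bullet> x = 0" by (rule common_orthogonal)
    have "on B \<subseteq> {covector N x, (\<lambda>n. - covector N x n)}"
    proof
      fix v assume v: "v \<in> on B"
      then have "v \<in> vertices" by (simp add: on_def)
      then obtain y where y: "v = covector N y" "y \<noteq> 0" by (metis vertexE)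
      then have "a \<bullet> y = 0" "b \<bullet> y = 0" using v ab covector_zero_iff by (auto simp: on_def)
      then show "v \<in> {covector N x, (\<lambda>n. - covector N x n)}" using covectors_on_two[of a b x y] ab x y by auto
    qed
    then have "card (on B) \<le> card {covector N x, (\<lambda>n. - covector N x n)}" by (intro card_mono) auto
    also have "\<dots> \<le> 2" by (simp add: card_insert_if)
    finally show "card (on B) \<le> 2" .
  qed
  also have "\<dots> = 2 * (card N choose 2)" using n_subsets[OF finite_N, of 2] by (simp add: pairs_def)
  also have "\<dots> = card N * (card N - 1)"
  proof -
    have "even (card N * (card N - 1))" by (cases "card N") auto
    then show ?thesis by (simp add: choose_two)
  qed
  finally show ?thesis .
qed

lemma card_vertices_less_card_cells: "card vertices < card cells"
proof -
  have "cells = slice {} N" by (simp add: cells_def slice_def)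
  moreover have "N \<noteq> {}" using card_N by auto
  ultimately have "card N * (card N - 1) + 2 \<le> card cells" using card_slice_0[of N] by simp
  then show ?thesis using card_vertices by linarith
qed

sublocale covector_system N vertices cells
proof
  show "finite N" "3 \<le> card N" by (fact finite_N card_N)+
  show "finite vertices" "finite cells" using finite_covectors[OF finite_N] by (auto simp: vertices_def cells_def)
  show "\<exists>a\<in>N. \<exists>b\<in>N. a \<noteq> b \<and> (\<forall>n\<in>N. v n = 0 \<longleftrightarrow> n = a \<or> n = b)" if v: "v \<in> vertices" for v
  proof -
    obtain x a b where x: "v = covector N x" "x \<noteq> 0" "a \<in> N" "b \<in> N" "a \<noteq> b" "a \<bullet> x = 0" "b \<bullet> x = 0"
      using v by (rule vertexE)
    have "\<forall>n\<in>N. v n = 0 \<longleftrightarrow> n = a \<or> n = b" using generic[of a b _ x] x covector_zero_iff by auto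
    then show ?thesis using x by blast
  qed
  show "w = v \<or> w = (\<lambda>n. - v n)" if vw: "v \<in> vertices" "w \<in> vertices" "a \<in> N" "b \<in> N" "a \<noteq> b"
    "v a = 0" "v b = 0" "w a = 0" "w b = 0" for v w a b
  proof -
    obtain x where x: "v = covector N x" "x \<noteq> 0" using vertexE[OF vw(1)] by metis
    obtain y where y: "w = covector N y" "y \<noteq> 0" using vertexE[OF vw(2)] by metis
    show ?thesis using covectors_on_two[of a b x y] x y vw covector_zero_iff by auto
  qed
  show "v n = 0 \<or> v n = 1 \<or> v n = -1" if "v \<in> vertices" for v n
    using that covector_range by (auto simp: vertices_def)
  show "f n = 1 \<or> f n = -1" if "f \<in> cells" "n \<in> N" for f n
    using that covector_range[of N _ n] covector_zero_iff by (auto simp: cells_def)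
  show "v n = 0" if "v \<in> vertices" "n \<notin> N" for v n using that by (auto simp: vertices_def covector_def)
  show "f n = 0" if "f \<in> cells" "n \<notin> N" for f n using that by (auto simp: cells_def covector_def)
qed (fact cell_at_vertex cell_has_vertex edge card_vertices_less_card_cells)+

end

section \<open>From faces on the sphere to covectors\<close>

lemma closure_face_sign:
  fixes n p w :: "real^3"
  assumes "connected C" "p \<in> C" "\<And>x. x \<in> C \<Longrightarrow> n \<bullet> x \<noteq> 0" "w \<in> closure C" "n \<bullet> w \<noteq> 0"
  shows "sgn (n \<bullet> w) = sgn (n \<bullet> p)"
proof -
  have pos: "0 < m \<bullet> w" if m: "0 < m \<bullet> p" "\<And>x. x \<in> C \<Longrightarrow> m \<bullet> x \<noteq> 0" "m \<bullet> w \<noteq> 0" for m :: "real^3"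
  proof -
    \<comment> \<open>By the intermediate value property \<open>C\<close> stays on one side of the
      plane, and the closed half-space also contains its closure.\<close>
    have "C \<subseteq> {x. m \<bullet> x \<ge> 0}"
    proof
      fix x assume "x \<in> C"
      show "x \<in> {x. m \<bullet> x \<ge> 0}"
      proof (rule ccontr)
        assume "\<not> ?thesis"
        then have "\<exists>z\<in>C. m \<bullet> z = 0"
          using connected_ivt_hyperplane[OF assms(1) \<open>x \<in> C\<close> assms(2), of m 0] m by auto
        then show False using m by auto
      qed
    qed
    then have "closure C \<subseteq> {x. m \<bullet> x \<ge> 0}" by (intro closure_minimal closed_halfspace_ge)
    then show ?thesis using assms(4) m(3) by force
  qed
  have "n \<bullet> p \<noteq> 0" using assms by auto
  then show ?thesis using pos[of n] pos[of "- n"] assms(3,5) by (cases "0 < n \<bullet> p") auto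
qed

theorem theorem2:
  fixes L :: "(real^3) set set"
  assumes "finite L" and "card L \<ge> 2"
    and "\<forall>l\<in>L. great_circle l"
    and "general_position L"
  shows "\<exists>v l1 l2. l1 \<in> L \<and> l2 \<in> L \<and> l1 \<noteq> l2 \<and> v \<in> l1 \<and> v \<in> l2 \<and>
           face_size (L - {l1, l2}) (arr_face (L - {l1, l2}) v) \<le> 5"
proof -
  obtain \<nu> where "\<forall>l\<in>L. \<nu> l \<noteq> 0 \<and> l = {x \<in> sphere 0 1. \<nu> l \<bullet> x = 0}"
    using assms(3) unfolding great_circle_def by metis
  then have \<nu>: "x \<in> l \<longleftrightarrow> norm x = 1 \<and> \<nu> l \<bullet> x = 0" if "l \<in> L" for l x
    using that by auto
  have inj: "inj_on \<nu> L"
  proof (rule inj_onI)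
    fix l m assume "l \<in> L" "m \<in> L" "\<nu> l = \<nu> m"
    then show "l = m" using \<nu>[of l] \<nu>[of m] by auto
  qed
  show ?thesis
  proof (cases "3 \<le> card L")
    case False
    \<comment> \<open>Deleting both circles leaves none, so there are no vertices and the size is
      0.\<close>
    then obtain l1 l2 where l: "L = {l1, l2}" "l1 \<noteq> l2" using assms(2) card_2_iff[of L] by auto
    obtain x where x: "x \<noteq> 0" "\<nu> l1 \<bullet> x = 0" "\<nu> l2 \<bullet> x = 0" by (rule common_orthogonal)
    have "(1 / norm x) *\<^sub>R x \<in> l1" "(1 / norm x) *\<^sub>R x \<in> l2" using \<nu> l x by auto
    moreover have "face_size (L - {l1, l2}) (arr_face (L - {l1, l2}) ((1 / norm x) *\<^sub>R x)) \<le> 5"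
      using l by (simp add: face_size_def arr_vertices_def)
    ultimately show ?thesis using l by blast
  next
    case True
    define N where "N = \<nu> ` L"
    interpret generic_normals N
    proof
      show "finite N" using assms(1) by (simp add: N_def)
      show "3 \<le> card N" using True by (simp add: N_def card_image[OF inj])
      fix a b c x assume *: "a \<in> N" "b \<in> N" "c \<in> N" "a \<noteq> b" "a \<noteq> c" "b \<noteq> c" "a \<bullet> x = 0" "b \<bullet> x = 0" "c \<bullet> x = 0"
      then obtain k l m where k: "k \<in> L" "l \<in> L" "m \<in> L" "a = \<nu> k" "b = \<nu> l" "c = \<nu> m" by (auto simp: N_def)
      show "x = 0"
      proof (rule ccontr)
        assume "x \<noteq> 0"
        then have "(1 / norm x) *\<^sub>R x \<in> k \<inter> l \<inter> m" using \<nu> k * by auto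
        moreover have "k \<noteq> l \<and> k \<noteq> m \<and> l \<noteq> m" using k * by auto
        then have "k \<inter> l \<inter> m = {}"
          using assms(4)[unfolded general_position_def, rule_format, OF k(1-3)] by simp
        ultimately show False by blast
      qed
    qed
    obtain v a b where v: "v \<in> vertices" "a \<in> N" "b \<in> N" "a \<noteq> b" "v a = 0" "v b = 0"
      and few: "card (visible v a b) \<le> 5" using few_visible by blast
    obtain x where x: "v = covector N x" "x \<noteq> 0" using vertexE[OF v(1)] by metis
    define p where "p = (1 / norm x) *\<^sub>R x"
    have p: "norm p = 1" "v = covector N p" using x covector_scale[of "1 / norm x" N x] by (auto simp: p_def)
    have ap: "a \<bullet> p = 0" "b \<bullet> p = 0" using v p covector_zero_iff by auto
    obtain l1 l2 where l: "l1 \<in> L" "l2 \<in> L" "a = \<nu> l1" "b = \<nu> l2" using v by (auto simp: N_def)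
    have l12: "l1 \<noteq> l2" using v l by auto
    have pl: "p \<in> l1" "p \<in> l2" using \<nu> l ap p by auto
    define L' where "L' = L - {l1, l2}"
    define C where "C = arr_face L' p"
    have C: "connected C" "C \<subseteq> sphere 0 1 - \<Union>L'"
      unfolding C_def arr_face_def by (auto simp: connected_component_subset)
    \<comment> \<open>Covectors embed the vertices on the frontier into
      \<open>visible v a b\<close>; the desired bound follows from this inequality.\<close>
    have "card {w \<in> arr_vertices L'. w \<in> frontier C} \<le> card (visible v a b)"
    proof (rule card_inj_on_le)
      show "finite (visible v a b)" using finite_V by (simp add: visible_def)
      have on_lines: "\<exists>c\<in>N. \<exists>d\<in>N. c \<noteq> d \<and> c \<notin> {a, b} \<and> d \<notin> {a, b} \<and> c \<bullet> w = 0 \<and> d \<bullet> w = 0 \<and> norm w = 1"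
        if w: "w \<in> arr_vertices L'" for w
      proof -
        obtain l3 l4 where l3: "l3 \<in> L'" "l4 \<in> L'" "l3 \<noteq> l4" "w \<in> l3" "w \<in> l4"
          using w by (auto simp: arr_vertices_def)
        then have "l3 \<in> L" "l4 \<in> L" by (auto simp: L'_def)
        then have "\<nu> l3 \<noteq> \<nu> l4" "\<nu> l3 \<notin> {a, b}" "\<nu> l4 \<notin> {a, b}" "\<nu> l3 \<in> N" "\<nu> l4 \<in> N"
          using l3 l inj by (auto simp: L'_def N_def inj_on_def)
        then show ?thesis using l3 \<nu>[OF \<open>l3 \<in> L\<close>] \<nu>[OF \<open>l4 \<in> L\<close>] by auto
      qed
      show "inj_on (covector N) {w \<in> arr_vertices L'. w \<in> frontier C}"
      proof (rule inj_onI)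
        fix w y assume wy: "w \<in> {w \<in> arr_vertices L'. w \<in> frontier C}" "y \<in> {w \<in> arr_vertices L'. w \<in> frontier C}"
          "covector N w = covector N y"
        then obtain c d where c: "c \<in> N" "d \<in> N" "c \<noteq> d" "c \<bullet> w = 0" "d \<bullet> w = 0" "norm w = 1"
          using on_lines by blast
        have ny: "norm y = 1" using wy(2) on_lines by blast
        have "c \<bullet> y = 0" "d \<bullet> y = 0" using c wy(3) covector_zero_iff by metis+
        moreover have "w \<noteq> 0" using c by auto
        ultimately obtain t where t: "y = t *\<^sub>R w" using proportional[of c d w y] c by blast
        then have "\<bar>t\<bar> = 1" using c ny by simp
        \<comment> \<open>Antipodal points lie on the same two circles, but a third normal gives
          them opposite signs.\<close>
        moreover have "t \<noteq> -1"
        proof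
          assume "t = -1"
          obtain n where n: "n \<in> N" "n \<noteq> c" "n \<noteq> d" by (rule third_normal)
          then have "n \<bullet> w \<noteq> 0" using generic[of c d n w] c \<open>w \<noteq> 0\<close> by auto
          then show False using fun_cong[OF wy(3), of n] t \<open>t = -1\<close> n by (auto simp: covector_def sgn_if split: if_splits)
        qed
        ultimately have "t = 1" by linarith
        then show "w = y" using t by simp
      qed
      show "covector N ` {w \<in> arr_vertices L'. w \<in> frontier C} \<subseteq> visible v a b"
      proof (rule image_subsetI)
        fix w assume w: "w \<in> {w \<in> arr_vertices L'. w \<in> frontier C}"
        then obtain c d where c: "c \<in> N" "d \<in> N" "c \<noteq> d" "c \<notin> {a, b}" "d \<notin> {a, b}" "c \<bullet> w = 0" "d \<bullet> w = 0" "norm w = 1"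
          using on_lines by blast
        have w0: "w \<noteq> 0" using c by auto
        have wC: "w \<in> closure C" using w by (simp add: frontier_def)
        \<comment> \<open>The component of a point on a removed circle would be empty, so a point in
          the closure of \<open>C\<close> shows that \<open>p\<close> belongs to it.\<close>
        have "C \<noteq> {}" using wC by auto
        then have pC: "p \<in> C" unfolding C_def arr_face_def
          by (metis connected_component_eq_empty connected_component_refl mem_Collect_eq)
        have "a \<bullet> w \<noteq> 0" "b \<bullet> w \<noteq> 0" using generic[of a c d w] generic[of b c d w] c v w0 by auto
        moreover have "sgn (n \<bullet> w) = sgn (n \<bullet> p)" if n: "n \<in> N - {a, b}" "n \<bullet> w \<noteq> 0" for n
        proof -
          obtain m where m: "m \<in> L" "n = \<nu> m" using n by (auto simp: N_def)
          then have "m \<in> L'" using n l by (auto simp: L'_def)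
          then have "n \<bullet> y \<noteq> 0" if "y \<in> C" for y
            using that C(2) \<nu>[OF m(1), of y] m by auto
          then show ?thesis using closure_face_sign[OF C(1) pC _ wC n(2)] by blast
        qed
        ultimately show "covector N w \<in> visible v a b"
          using vertexI[OF w0 c(1,2,3,6,7)] v(2,3) p(2)
          by (auto simp: visible_def covector_def sgn_zero_iff)
      qed
    qed
    then have "face_size L' C \<le> 5" using few by (simp add: face_size_def)
    then show ?thesis using l l12 pl unfolding L'_def C_def by blast
  qed
qed

end
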